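(* Assume the observation model, the exchangeable exponential moment condition on $\xi$ with constants $\beta\in(0,1]$, $B>0$, and the empirical Bayes construction with prior parameter $\varkappa$ described in the context, and assume $\varkappa>\bar\varkappa:=(12-\beta+4B)/(4\beta)$. Let $\hat\theta$ be either $\tilde\theta$ or $\check\theta$, let $\hat r^2=\sigma^2+\sigma^2|\hat I|\log(en/|\hat I|)$, and let $\Theta_{\rm eb}(t)$ be the excessive bias restriction class defined in the context (with fixed $\varrho$, $\tau_0$). Then there exist constants $M_2,H_2,m_2>0$ and $M_0',H_0'>0$, depending only on $\beta,B,\varkappa,\varrho,\tau_0$, such that for any $t,M\ge0$, with $\hat R_M^2=(t+1)M_2\hat r^2+(t+2)M\sigma^2$, $$\sup_{\theta\in\Theta_{\rm eb}(t)}\mathrm{P}_\theta\big(\theta\notin B(\hat\theta,\hat R_M)\big)\le H_2e^{-m_2M},$$ $$\sup_{\theta\in\mathbb{R}^n}\mathrm{P}_\theta\big(\hat r^2\ge M_0'\sigma^2|I_o|\log(\tfrac{en}{|I_o|})+(M+1)\sigma^2\big)\le H_0'e^{-M}.$$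
   Context: Model. $n\in\mathbb{N}$, $[n]=\{1,\dots,n\}$, $\sigma>0$ known, $\theta\in\mathbb{R}^n$ unknown. One observes $X=(X_1,\dots,X_n)$, $X_i=\theta_i+\sigma\xi_i$, $i\in[n]$, where $\xi=(\xi_1,\dots,\xi_n)$ is a random vector (its distribution is unknown, may depend on $\theta$, and its coordinates need not be independent or normal) with $\mathrm{E}\xi_i=0$, $\mathrm{Var}(\xi_i)\le 1$. $\mathrm{P}_\theta,\mathrm{E}_\theta$ denote the law of $X$ and its expectation. $\|\cdot\|$ is the Euclidean norm and $B(\hat\theta,R)=\{\theta\in\mathbb{R}^n:\|\hat\theta-\theta\|\le R\}$. Exchangeable exponential moment condition with constants $\beta\in(0,1]$, $B>0$: $\mathrm{E}\exp\{\beta\sum_{i\in I}\xi_i^2\}\le e^{B|I|}$ for all $I\subseteq[n]$ (for every $\theta$, if the law of $\xi$ depends on $\theta$). Conventions. $\mathcal{I}$ is the family of all subsets of $[n]$ (including $\varnothing$), $I^c=[n]\setminus I$, $0\log(c/0)=0$ and $(c/0)^0=1$ for $c>0$, $\phi(x,\mu,s^2)$ is the $\mathrm{N}(\mu,s^2)$ density at $x$, $X(I)=(X_i\mathbf{1}\{i\in I\})_{i\in[n]}$. Empirical Bayes construction. Fix $\varkappa>1$. Let $\lambda_I=c_{\varkappa,n}(en/|I|)^{-\varkappa|I|}$, $I\in\mathcal{I}$, with $c_{\varkappa,n}$ normalizing so that $\sum_{I}\lambda_I=1$; $K_n(I)=(\frac{en}{|I|}-1)\mathbf{1}\{I\ne\varnothing\}$;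 $\tau_i^2(I)=\sigma^2K_n(I)\mathbf{1}\{i\in I\}$; $\mathrm{P}_{X,I}=\prod_{i=1}^n\phi(X_i,X_i\mathbf{1}\{i\in I\},\sigma^2+\tau_i^2(I))$. Define $\tilde\pi(I|X)=\lambda_I\mathrm{P}_{X,I}/\sum_{J\in\mathcal{I}}\lambda_J\mathrm{P}_{X,J}$; $\tilde\theta=\sum_{I}X(I)\tilde\pi(I|X)$; $\hat I$ any maximizer of $\tilde\pi(I|X)$ over $I\in\mathcal{I}$, equivalently any minimizer of $\sum_{i\in I^c}X_i^2+(2\varkappa+1)\sigma^2|I|\log(\frac{en}{|I|})$; $\check\theta=X(\hat I)$. Oracles. For $s^2>0$, $I_o(\theta,s^2)\in\mathcal{I}$ denotes the minimizer over $I\in\mathcal{I}$ of $\sum_{i\in I^c}\theta_i^2+s^2|I|\log(\frac{en}{|I|})$ (if not unique, the one with the earliest coordinates is taken), and $I_o=I_o(\theta)=I_o(\theta,\sigma^2)$. Excessive bias restriction (EBR) class. Let $\bar\tau=3(\varkappa\beta+\frac\beta2+B)/\beta$; fix $\varrho\in(0,1)$ and $\tau_0>\frac{1+\varrho}{1-\varrho}\bar\tau$, and put $I_*=I_*(\theta)=I_o(\theta,\tau_0\sigma^2)$. For $t\ge0$, $$\Theta_{\rm eb}(t)=\Big\{\theta\in\mathbb{R}^n:\ \sum_{i\in I_*^c}\theta_i^2\le t\sigma^2\big(1+|I_*|\log(\tfrac{en}{|I_*|})\big)\Big\}.$$ *)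

theory Defs
  imports "HOL-Probability.Probability" "HOL-Library.List_Lexorder"
begin

text \<open>The constants of the theorem must not depend on the dimension n, so n cannot be a type:
  a vector of R^n is a function in \<^term>\<open>space (\<Pi>\<^sub>M i\<in>{1..n}. borel)\<close>, undefined outside of
  \<^term>\<open>{1..n}\<close>. For the same reason the noise enters through its law on this fixed measurable
  space rather than through a sample space of an arbitrary type.\<close>

abbreviation Rn :: "nat \<Rightarrow> (nat \<Rightarrow> real) measure" where
  "Rn n \<equiv> (\<Pi>\<^sub>M i\<in>{1..n}. borel)"

definition Rball :: "nat \<Rightarrow> (nat \<Rightarrow> real) \<Rightarrow> real \<Rightarrow> (nat \<Rightarrow> real) set" where
  "Rball n c R = {\<theta> \<in> space (Rn n). L2_set (\<lambda>i. c i - \<theta> i) {1..n} \<le> R}"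

definition coord_part :: "nat \<Rightarrow> (nat \<Rightarrow> real) \<Rightarrow> nat set \<Rightarrow> nat \<Rightarrow> real" where
  "coord_part n X I = (\<lambda>i\<in>{1..n}. X i * indicator I i)"

text \<open>Since \<^prop>\<open>x / 0 = (0::real)\<close> and \<^prop>\<open>ln 0 = (0::real)\<close>, the value at the empty set is 0.\<close>

definition ell :: "nat \<Rightarrow> nat set \<Rightarrow> real" where
  "ell n I = real (card I) * ln (exp 1 * real n / real (card I))"


subsection \<open>The observation model\<close>

definition noise_law :: "nat \<Rightarrow> (nat \<Rightarrow> real) measure \<Rightarrow> bool" where
  "noise_law n Q \<longleftrightarrow> prob_space Q \<and> sets Q = sets (Rn n) \<and>
     (\<forall>i\<in>{1..n}. integrable Q (\<lambda>\<xi>. \<xi> i) \<and> integrable Q (\<lambda>\<xi>. (\<xi> i)\<^sup>2) \<and>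
        prob_space.expectation Q (\<lambda>\<xi>. \<xi> i) = 0 \<and> prob_space.variance Q (\<lambda>\<xi>. \<xi> i) \<le> 1)"

definition exch_exp_moment :: "nat \<Rightarrow> real \<Rightarrow> real \<Rightarrow> (nat \<Rightarrow> real) measure \<Rightarrow> bool" where
  "exch_exp_moment n \<beta> B Q \<longleftrightarrow>
     (\<forall>I\<subseteq>{1..n}. (\<integral>\<^sup>+ \<xi>. ennreal (exp (\<beta> * (\<Sum>i\<in>I. (\<xi> i)\<^sup>2))) \<partial>Q) \<le> ennreal (exp (B * real (card I))))"

text \<open>The law of \<open>X = \<theta> + \<sigma> \<xi>\<close> when \<open>\<xi>\<close> has law \<open>Q\<close>.\<close>

definition obs_law :: "nat \<Rightarrow> real \<Rightarrow> (nat \<Rightarrow> real) measure \<Rightarrow> (nat \<Rightarrow> real) \<Rightarrow> (nat \<Rightarrow> real) measure" where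
  "obs_law n \<sigma> Q \<theta> = distr Q (Rn n) (\<lambda>\<xi>. \<lambda>i\<in>{1..n}. \<theta> i + \<sigma> * \<xi> i)"


subsection \<open>The empirical Bayes construction\<close>

text \<open>The case distinction is the convention \<open>(c/0)\<^sup>0 = 1\<close>, as \<^prop>\<open>0 powr 0 = (0::real)\<close>.\<close>

definition prior_weight :: "nat \<Rightarrow> real \<Rightarrow> nat set \<Rightarrow> real" where
  "prior_weight n \<kappa> I =
     (if I = {} then 1 else (exp 1 * real n / real (card I)) powr (- \<kappa> * real (card I)))"

definition prior :: "nat \<Rightarrow> real \<Rightarrow> nat set \<Rightarrow> real" where
  "prior n \<kappa> I = prior_weight n \<kappa> I / (\<Sum>J\<in>Pow {1..n}. prior_weight n \<kappa> J)"

definition Kn :: "nat \<Rightarrow> nat set \<Rightarrow> real" where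
  "Kn n I = (if I = {} then 0 else exp 1 * real n / real (card I) - 1)"

definition tau2 :: "nat \<Rightarrow> real \<Rightarrow> nat set \<Rightarrow> nat \<Rightarrow> real" where
  "tau2 n \<sigma> I i = \<sigma>\<^sup>2 * Kn n I * indicator I i"

text \<open>\<^const>\<open>normal_density\<close> is parametrized by the standard deviation.\<close>

definition marginal :: "nat \<Rightarrow> real \<Rightarrow> (nat \<Rightarrow> real) \<Rightarrow> nat set \<Rightarrow> real" where
  "marginal n \<sigma> X I =
     (\<Prod>i\<in>{1..n}. normal_density (X i * indicator I i) (sqrt (\<sigma>\<^sup>2 + tau2 n \<sigma> I i)) (X i))"

definition post :: "nat \<Rightarrow> real \<Rightarrow> real \<Rightarrow> (nat \<Rightarrow> real) \<Rightarrow> nat set \<Rightarrow> real" where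
  "post n \<sigma> \<kappa> X I = prior n \<kappa> I * marginal n \<sigma> X I /
     (\<Sum>J\<in>Pow {1..n}. prior n \<kappa> J * marginal n \<sigma> X J)"

definition theta_tilde :: "nat \<Rightarrow> real \<Rightarrow> real \<Rightarrow> (nat \<Rightarrow> real) \<Rightarrow> nat \<Rightarrow> real" where
  "theta_tilde n \<sigma> \<kappa> X =
     (\<lambda>i\<in>{1..n}. \<Sum>I\<in>Pow {1..n}. coord_part n X I i * post n \<sigma> \<kappa> X I)"

text \<open>Ties may be broken arbitrarily, but measurably, so that the events below have a probability.\<close>

definition eb_selector :: "nat \<Rightarrow> real \<Rightarrow> real \<Rightarrow> ((nat \<Rightarrow> real) \<Rightarrow> nat set) \<Rightarrow> bool" where
  "eb_selector n \<sigma> \<kappa> Ihat \<longleftrightarrow> Ihat \<in> Rn n \<rightarrow>\<^sub>M count_space (Pow {1..n}) \<and>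
     (\<forall>X\<in>space (Rn n). is_arg_max (post n \<sigma> \<kappa> X) (\<lambda>I. I \<in> Pow {1..n}) (Ihat X))"

definition theta_check :: "nat \<Rightarrow> ((nat \<Rightarrow> real) \<Rightarrow> nat set) \<Rightarrow> (nat \<Rightarrow> real) \<Rightarrow> nat \<Rightarrow> real" where
  "theta_check n Ihat X = coord_part n X (Ihat X)"

definition rhat2 :: "nat \<Rightarrow> real \<Rightarrow> ((nat \<Rightarrow> real) \<Rightarrow> nat set) \<Rightarrow> (nat \<Rightarrow> real) \<Rightarrow> real" where
  "rhat2 n \<sigma> Ihat X = \<sigma>\<^sup>2 + \<sigma>\<^sup>2 * ell n (Ihat X)"


subsection \<open>Oracles and the excessive bias restriction\<close>

definition oracle_minimizers :: "nat \<Rightarrow> (nat \<Rightarrow> real) \<Rightarrow> real \<Rightarrow> nat set set" where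
  "oracle_minimizers n \<theta> s2 =
     {I. is_arg_min (\<lambda>I. (\<Sum>i\<in>{1..n} - I. (\<theta> i)\<^sup>2) + s2 * ell n I) (\<lambda>I. I \<in> Pow {1..n}) I}"

text \<open>Among several minimizers the one with the earliest coordinates is taken: the one whose
  increasing list of elements is lexicographically smallest (a proper prefix being smaller).\<close>

definition oracle_set :: "nat \<Rightarrow> (nat \<Rightarrow> real) \<Rightarrow> real \<Rightarrow> nat set" where
  "oracle_set n \<theta> s2 = set (Min (sorted_list_of_set ` oracle_minimizers n \<theta> s2))"

definition tau_bar :: "real \<Rightarrow> real \<Rightarrow> real \<Rightarrow> real" where
  "tau_bar \<beta> B \<kappa> = 3 * (\<kappa> * \<beta> + \<beta> / 2 + B) / \<beta>"

definition eb_class :: "nat \<Rightarrow> real \<Rightarrow> real \<Rightarrow> real \<Rightarrow> (nat \<Rightarrow> real) set" where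
  "eb_class n \<sigma> \<tau>0 t = {\<theta> \<in> space (Rn n).
     let Istar = oracle_set n \<theta> (\<tau>0 * \<sigma>\<^sup>2)
     in (\<Sum>i\<in>{1..n} - Istar. (\<theta> i)\<^sup>2) \<le> t * \<sigma>\<^sup>2 * (1 + ell n Istar)}"

lemma oracle_set_in_minimizers: "oracle_set n \<theta> s2 \<in> oracle_minimizers n \<theta> s2"
proof -
  have sub: "oracle_minimizers n \<theta> s2 \<subseteq> Pow {1..n}"
    by (auto simp: oracle_minimizers_def is_arg_min_def)
  then have fin: "finite (oracle_minimizers n \<theta> s2)"
    by (rule finite_subset) simp
  have "oracle_minimizers n \<theta> s2 \<noteq> {}"
    using ex_is_arg_min_if_finite[of "Pow {1..n}"] by (auto simp: oracle_minimizers_def)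
  with fin have "Min (sorted_list_of_set ` oracle_minimizers n \<theta> s2) \<in> sorted_list_of_set ` oracle_minimizers n \<theta> s2"
    by (intro Min_in) auto
  then obtain I where "I \<in> oracle_minimizers n \<theta> s2" "oracle_set n \<theta> s2 = set (sorted_list_of_set I)"
    by (auto simp: oracle_set_def)
  moreover from this sub have "finite I"
    by (meson PowD finite_atLeastAtMost finite_subset subsetD)
  ultimately show ?thesis
    by simp
qed

end

theory Submission
  imports Defs
begin

text \<open>The posterior weight of \<open>I\<close> is proportional to \<open>exp (- crit I / 2)\<close>, where, at scale \<open>\<sigma> = 1\<close>,
  \<open>crit I = (\<Sum>i\<in>I\<^sup>c. X\<^sub>i\<^sup>2) + (2 * \<kappa> + 1) * ell I\<close>. Since there are at most \<open>exp (ell I)\<close> sets of the size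
  of \<open>I\<close>, a union bound controls the noise on all sets simultaneously, by a multiple of \<open>ell I\<close>; the
  rest is deterministic on this event. Comparing the criterion at \<open>I\<close> with that at the oracle \<open>J\<close> shows
  that \<open>I\<close> is not much larger than \<open>J\<close>, as \<open>\<kappa>\<close> is large; comparing it with that at \<open>I \<union> J\<close> shows that
  the signal on \<open>J - I\<close> is not much larger than \<open>ell J\<close>, and by minimality of the oracle that \<open>J\<close> is
  not much larger than \<open>I\<close>, as \<open>\<tau>0\<close> is large. Both comparisons hold for the mode of the posterior and,
  up to exponentially small weights, on average over it.\<close>

section \<open>The complexity \<open>ell\<close>, the count of subsets, and Jensen's
  inequality\<close>

text \<open>The factor \<open>exp 1\<close> keeps the logarithm at least 1, since
  \<open>card I\<close> is at most \<open>n\<close>.\<close>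

lemma card_le_ell:
  assumes "I \<subseteq> {1..n}" shows "real (card I) \<le> ell n I"
proof (cases "card I = 0")
  case False
  have "card I \<le> n" using card_mono[OF _ assms] by simp
  with False have "ln (exp 1) \<le> ln (exp 1 * real n / real (card I))"
    by (subst ln_le_cancel_iff) (auto simp: field_simps)
  then show ?thesis
    using mult_left_mono[of 1 _ "real (card I)"] by (simp add: ell_def)
qed (simp add: ell_def)

lemma ell_nonneg: "I \<subseteq> {1..n} \<Longrightarrow> 0 \<le> ell n I"
  using card_le_ell[of I n] by linarith

lemma ell_eq:
  assumes "I \<subseteq> {1..n}"
  shows "ell n I = real (card I) * (1 + ln (real n) - ln (real (card I)))"
proof (cases "card I = 0")
  case False
  then have "0 < n" using assms by (cases n) auto
  with False show ?thesis by (simp add: ell_def ln_div ln_mult)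
qed (simp add: ell_def)

text \<open>The function \<open>x * (1 + ln n - ln x)\<close> increases on \<open>(0, n]\<close>.
  Instead of a derivative, the proof uses \<open>ln x \<le> x - 1\<close> at
  \<open>x = b / a\<close>, together with \<open>b \<le> n\<close>.\<close>

lemma ell_mono:
  assumes "I \<subseteq> J" "J \<subseteq> {1..n}" shows "ell n I \<le> ell n J"
proof (cases "card I = 0")
  case True
  then show ?thesis using ell_nonneg[OF assms(2)] by (simp add: ell_def)
next
  case False
  have I: "I \<subseteq> {1..n}" using assms by blast
  define a b where "a = real (card I)" and "b = real (card J)"
  have "finite J" using assms(2) finite_subset by blast
  then have ab: "0 < a" "a \<le> b" and bn: "b \<le> real n"
    using False card_mono[OF _ assms(1)] card_mono[OF _ assms(2)] by (auto simp: a_def b_def)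
  have "a * ln (b / a) \<le> a * (b / a - 1)"
    using ab by (intro mult_left_mono ln_le_minus_one) auto
  then have *: "a * (ln b - ln a) \<le> b - a"
    using ab by (simp add: ln_div right_diff_distrib)
  have "ln b \<le> ln (real n)" using ab bn by simp
  then have "0 \<le> (b - a) * (ln (real n) - ln b)" using ab by simp
  with * have "a * (1 + ln (real n) - ln a) \<le> b * (1 + ln (real n) - ln b)"
    by (simp add: algebra_simps)
  then show ?thesis
    unfolding ell_eq[OF I] ell_eq[OF assms(2)] a_def b_def .
qed

text \<open>Replacing both logarithms by the smaller one at \<open>u = card (I \<union> J)\<close>
  lowers the right-hand side; what remains is \<open>u \<le> card I + card J\<close>.\<close>

lemma ell_Un_le:
  assumes "I \<subseteq> {1..n}" "J \<subseteq> {1..n}"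
  shows "ell n (I \<union> J) \<le> ell n I + ell n J"
proof -
  define u where "u = real (card (I \<union> J))"
  have IJ: "I \<union> J \<subseteq> {1..n}" using assms by blast
  have fin: "finite (I \<union> J)" using IJ finite_subset by blast
  have cu: "u \<le> real n" using card_mono[OF _ IJ] by (simp add: u_def)
  have le: "real (card A) * (1 + ln (real n) - ln u) \<le> ell n A" if "A \<subseteq> I \<union> J" for A
  proof (cases "card A = 0")
    case False
    have "card A \<le> card (I \<union> J)" using card_mono[OF fin that] .
    then have "ln (real (card A)) \<le> ln u" using False by (simp add: u_def)
    then show ?thesis
      using that IJ by (subst ell_eq) (auto intro!: mult_left_mono)
  qed (simp add: ell_def)
  show ?thesis
  proof (cases "u = 0")
    case True
    then show ?thesis using ell_nonneg[OF assms(1)] ell_nonneg[OF assms(2)] by (simp add: ell_def u_def)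
  next
    case False
    then have "ln u \<le> ln (real n)" using cu by (simp add: u_def)
    moreover have "u \<le> real (card I) + real (card J)"
      using card_Un_le[of I J] by (simp add: u_def)
    ultimately have "u * (1 + ln (real n) - ln u) \<le> (real (card I) + real (card J)) * (1 + ln (real n) - ln u)"
      by (intro mult_right_mono) auto
    also have "\<dots> \<le> ell n I + ell n J"
      using le[of I] le[of J] by (simp add: algebra_simps)
    finally show ?thesis by (simp add: ell_eq[OF IJ] u_def)
  qed
qed

text \<open>The left-hand side is a single term of the exponential series at \<open>k\<close>. It
  yields the bound \<open>(exp 1 * n / k) ^ k\<close> on the binomial coefficient.\<close>

lemma pow_self_div_fact_le_exp: "real k ^ k / fact k \<le> exp (real k)"
proof -
  have "(\<Sum>i\<in>{k}. real k ^ i / fact i) \<le> (\<Sum>i. real k ^ i / fact i)"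
    using summable_exp[of "real k"] by (intro sum_le_suminf) (auto simp: field_simps)
  then show ?thesis by (simp add: exp_def scaleR_conv_of_real field_simps)
qed

text \<open>Grouped by size: there are at most \<open>exp (ell n I)\<close> sets of the size
  \<open>k\<close> of \<open>I\<close>, which uses up the 1 in \<open>1 + a\<close>. As
  \<open>ell n I \<ge> k\<close>, they contribute at most \<open>exp (- a) ^ k\<close>, and the
  geometric series gives a bound free of \<open>n\<close>.\<close>

lemma sum_exp_neg_ell_le:
  fixes a :: real
  assumes a: "0 < a"
  shows "(\<Sum>I\<in>Pow {1..n}. exp (- (1 + a) * ell n I)) \<le> 1 / (1 - exp (- a))"
proof -
  have fib: "(\<Sum>I\<in>{I\<in>Pow {1..n}. card I = k}. exp (- (1 + a) * ell n I)) \<le> exp (- a) ^ k"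
    if k: "k \<le> n" for k
  proof -
    define e where "e = real k * ln (exp 1 * real n / real k)"
    have "real (n choose k) \<le> exp e"
    proof (cases "k = 0")
      case False
      then have np: "0 < real n" "0 < real k" using k by auto
      have "real (n choose k) * fact k \<le> real n ^ k"
        using binomial_fact_pow[of n k] by (metis of_nat_fact of_nat_le_iff of_nat_mult of_nat_power)
      then have "real (n choose k) \<le> (real n / real k) ^ k * (real k ^ k / fact k)"
        using np by (simp add: field_simps)
      also have "\<dots> \<le> (real n / real k) ^ k * exp (real k)"
        by (intro mult_left_mono pow_self_div_fact_le_exp) auto
      also have "\<dots> = (exp 1 * real n / real k) ^ k"
        by (simp add: power_divide power_mult_distrib flip: exp_of_nat_mult)
      also have "\<dots> = exp e"
        unfolding e_def using np by (subst exp_of_nat_mult) auto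
      finally show ?thesis .
    qed (simp add: e_def)
    have ek: "ell n I = e" if "card I = k" for I using that by (simp add: ell_def e_def)
    have ke: "real k \<le> e"
      using card_le_ell[of "{1..k}" n] ek[of "{1..k}"] k by simp
    have "(\<Sum>I\<in>{I\<in>Pow {1..n}. card I = k}. exp (- (1 + a) * ell n I))
        = real (n choose k) * exp (- (1 + a) * e)"
      using n_subsets[of "{1..n}" k] ek by (simp add: Pow_def)
    also have "\<dots> \<le> exp e * exp (- (1 + a) * e)"
      using \<open>real (n choose k) \<le> exp e\<close> by (intro mult_right_mono) auto
    also have "\<dots> = exp (- a * e)"
      unfolding exp_add[symmetric] by (simp add: algebra_simps)
    also have "\<dots> \<le> exp (- a * real k)" using ke a by simp
    finally show ?thesis by (simp add: mult.commute flip: exp_of_nat_mult)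
  qed
  have "(\<Sum>I\<in>Pow {1..n}. exp (- (1 + a) * ell n I))
      = (\<Sum>k\<in>{..n}. \<Sum>I\<in>{I\<in>Pow {1..n}. card I = k}. exp (- (1 + a) * ell n I))"
    using card_mono[of "{1..n}"] by (subst sum.group) (auto simp: Pow_def)
  also have "\<dots> \<le> (\<Sum>k\<in>{..n}. exp (- a) ^ k)"
    using fib by (intro sum_mono) simp
  also have "\<dots> \<le> (\<Sum>k. exp (- a) ^ k)"
    using a by (intro sum_le_suminf summable_geometric) auto
  also have "\<dots> = 1 / (1 - exp (- a))"
    using a by (intro suminf_geometric) simp
  finally show ?thesis .
qed

text \<open>Jensen's inequality for the square: the variance under the weights \<open>w\<close> is
  nonnegative.\<close>

lemma square_sum_weighted_le:
  fixes w x :: "'a \<Rightarrow> real"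
  assumes "\<And>i. i \<in> A \<Longrightarrow> 0 \<le> w i" "sum w A = 1"
  shows "(\<Sum>i\<in>A. w i * x i)\<^sup>2 \<le> (\<Sum>i\<in>A. w i * (x i)\<^sup>2)"
proof -
  define m where "m = (\<Sum>i\<in>A. w i * x i)"
  have "0 \<le> (\<Sum>i\<in>A. w i * (x i - m)\<^sup>2)"
    using assms(1) by (intro sum_nonneg) auto
  also have "\<dots> = (\<Sum>i\<in>A. w i * (x i)\<^sup>2 - 2 * m * (w i * x i) + m\<^sup>2 * w i)"
    by (intro sum.cong) (auto simp: power2_eq_square algebra_simps)
  also have "\<dots> = (\<Sum>i\<in>A. w i * (x i)\<^sup>2) - 2 * m * m + m\<^sup>2"
    by (simp add: sum.distrib sum_subtractf assms(2) m_def flip: sum_distrib_left)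
  finally show ?thesis by (simp add: m_def power2_eq_square)
qed

section \<open>Increments of the penalized criterion\<close>

definition crit :: "nat \<Rightarrow> real \<Rightarrow> (nat \<Rightarrow> real) \<Rightarrow> nat set \<Rightarrow> real" where
  "crit n \<kappa> y I = (\<Sum>i\<in>{1..n} - I. (y i)\<^sup>2) + (2 * \<kappa> + 1) * ell n I"

text \<open>Passing from \<open>I\<close> to \<open>J\<close> adds at most the residuals on
  \<open>I - J\<close>, and there
  \<open>y\<^sup>2 \<le> 2 * \<eta>\<^sup>2 + 2 * \<xi>\<^sup>2\<close>. The penalty on
  \<open>I\<close> has to outweigh them.\<close>

lemma crit_diff_ge:
  assumes "I \<subseteq> {1..n}" and y: "\<And>i. i \<in> {1..n} \<Longrightarrow> y i = \<eta> i + \<xi> i"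
  shows "crit n \<kappa> y I - crit n \<kappa> y J \<ge>
    (2 * \<kappa> + 1) * (ell n I - ell n J) - 2 * (\<Sum>i\<in>I. (\<xi> i)\<^sup>2) - 2 * (\<Sum>i\<in>I - J. (\<eta> i)\<^sup>2)"
proof -
  have fI: "finite I" using assms(1) finite_subset by blast
  have "(\<Sum>i\<in>{1..n} - J. (y i)\<^sup>2) \<le> (\<Sum>i\<in>({1..n} - I) \<union> (I - J). (y i)\<^sup>2)"
    using fI by (intro sum_mono2) auto
  also have "\<dots> = (\<Sum>i\<in>{1..n} - I. (y i)\<^sup>2) + (\<Sum>i\<in>I - J. (y i)\<^sup>2)"
    using fI by (intro sum.union_disjoint) auto
  also have "(\<Sum>i\<in>I - J. (y i)\<^sup>2) \<le> (\<Sum>i\<in>I - J. 2 * (\<eta> i)\<^sup>2 + 2 * (\<xi> i)\<^sup>2)"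
  proof (intro sum_mono)
    fix i assume "i \<in> I - J"
    then have "y i = \<eta> i + \<xi> i" using y assms(1) by blast
    moreover have "0 \<le> (\<eta> i - \<xi> i)\<^sup>2" by simp
    ultimately show "(y i)\<^sup>2 \<le> 2 * (\<eta> i)\<^sup>2 + 2 * (\<xi> i)\<^sup>2"
      by (simp add: power2_eq_square algebra_simps)
  qed
  also have "\<dots> = 2 * (\<Sum>i\<in>I - J. (\<eta> i)\<^sup>2) + 2 * (\<Sum>i\<in>I - J. (\<xi> i)\<^sup>2)"
    by (simp add: sum.distrib sum_distrib_left)
  also have "(\<Sum>i\<in>I - J. (\<xi> i)\<^sup>2) \<le> (\<Sum>i\<in>I. (\<xi> i)\<^sup>2)"
    using fI by (intro sum_mono2) auto
  finally show ?thesis by (simp add: crit_def algebra_simps)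
qed

text \<open>Adding \<open>J\<close> to \<open>I\<close> removes exactly the residuals on
  \<open>J - I\<close>, while by subadditivity the penalty grows by at most that of
  \<open>J\<close>. Signal on \<open>J\<close> that \<open>I\<close> misses thus makes
  \<open>I\<close> expensive.\<close>

lemma crit_diff_Un_ge:
  assumes "I \<subseteq> {1..n}" "J \<subseteq> {1..n}" and y: "\<And>i. i \<in> {1..n} \<Longrightarrow> y i = \<eta> i + \<xi> i"
    and "0 \<le> \<kappa>"
  shows "crit n \<kappa> y I - crit n \<kappa> y (I \<union> J) \<ge>
    2 / 3 * (\<Sum>i\<in>J - I. (\<eta> i)\<^sup>2) - 2 * (\<Sum>i\<in>J. (\<xi> i)\<^sup>2) - (2 * \<kappa> + 1) * ell n J"
proof -
  have fJ: "finite J" using assms(2) finite_subset by blast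
  have eq: "{1..n} - I = ({1..n} - (I \<union> J)) \<union> (J - I)" using assms(2) by auto
  have "(\<Sum>i\<in>{1..n} - I. (y i)\<^sup>2) = (\<Sum>i\<in>{1..n} - (I \<union> J). (y i)\<^sup>2) + (\<Sum>i\<in>J - I. (y i)\<^sup>2)"
    unfolding eq using fJ by (intro sum.union_disjoint) auto
  moreover have "(\<Sum>i\<in>J - I. 2 / 3 * (\<eta> i)\<^sup>2 - 2 * (\<xi> i)\<^sup>2) \<le> (\<Sum>i\<in>J - I. (y i)\<^sup>2)"
  proof (intro sum_mono)
    fix i assume "i \<in> J - I"
    then have "y i = \<eta> i + \<xi> i" using y assms(2) by blast
    \<comment> \<open>The identity is \<open>y\<^sup>2 = 2 / 3 * \<eta>\<^sup>2 - 2 * \<xi>\<^sup>2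
      + (\<eta> + 3 * \<xi>)\<^sup>2 / 3\<close>. These weights lead to the constant in
      \<open>tau_bar\<close>: 3/2 times \<open>2 * b + 2 * \<kappa> + 1\<close> is
      \<open>3 * \<kappa> + 3 / 2 + 3 * b\<close>.\<close>
    moreover have "0 \<le> (\<eta> i + 3 * \<xi> i)\<^sup>2" by simp
    ultimately show "2 / 3 * (\<eta> i)\<^sup>2 - 2 * (\<xi> i)\<^sup>2 \<le> (y i)\<^sup>2"
      by (simp add: power2_eq_square algebra_simps)
  qed
  then have "2 / 3 * (\<Sum>i\<in>J - I. (\<eta> i)\<^sup>2) - 2 * (\<Sum>i\<in>J - I. (\<xi> i)\<^sup>2) \<le> (\<Sum>i\<in>J - I. (y i)\<^sup>2)"
    by (simp add: sum_subtractf sum_distrib_left)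
  moreover have "(\<Sum>i\<in>J - I. (\<xi> i)\<^sup>2) \<le> (\<Sum>i\<in>J. (\<xi> i)\<^sup>2)"
    using fJ by (intro sum_mono2) auto
  moreover have "(2 * \<kappa> + 1) * ell n (I \<union> J) \<le> (2 * \<kappa> + 1) * (ell n I + ell n J)"
    using assms ell_Un_le by (intro mult_left_mono) auto
  ultimately show ?thesis by (simp add: crit_def algebra_simps)
qed

section \<open>Oracle sets at unit noise scale\<close>

text \<open>Here \<open>\<eta>\<close> stands for \<open>\<theta> / \<sigma>\<close>; dividing the
  oracle objective by \<open>\<sigma>\<^sup>2\<close> turns the penalty factor
  \<open>\<tau> * \<sigma>\<^sup>2\<close> into \<open>\<tau>\<close>.\<close>

definition is_oracle :: "nat \<Rightarrow> real \<Rightarrow> (nat \<Rightarrow> real) \<Rightarrow> nat set \<Rightarrow> bool" where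
  "is_oracle n \<tau> \<eta> J \<longleftrightarrow> J \<subseteq> {1..n} \<and> (\<forall>I\<subseteq>{1..n}.
     (\<Sum>i\<in>{1..n} - J. (\<eta> i)\<^sup>2) + \<tau> * ell n J \<le> (\<Sum>i\<in>{1..n} - I. (\<eta> i)\<^sup>2) + \<tau> * ell n I)"

lemma is_oracle_oracle_set:
  assumes "0 < \<sigma>"
  shows "is_oracle n \<tau> (\<lambda>i. \<theta> i / \<sigma>) (oracle_set n \<theta> (\<tau> * \<sigma>\<^sup>2))"
proof -
  let ?J = "oracle_set n \<theta> (\<tau> * \<sigma>\<^sup>2)"
  have J: "?J \<subseteq> {1..n}" and min: "\<And>I. I \<subseteq> {1..n} \<Longrightarrow>
      (\<Sum>i\<in>{1..n} - ?J. (\<theta> i)\<^sup>2) + \<tau> * \<sigma>\<^sup>2 * ell n ?J \<le> (\<Sum>i\<in>{1..n} - I. (\<theta> i)\<^sup>2) + \<tau> * \<sigma>\<^sup>2 * ell n I"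
    using oracle_set_in_minimizers[of n \<theta> "\<tau> * \<sigma>\<^sup>2"]
    by (auto simp: oracle_minimizers_def is_arg_min_linorder)
  have scale: "(\<Sum>i\<in>{1..n} - I. (\<theta> i / \<sigma>)\<^sup>2) + \<tau> * ell n I =
      ((\<Sum>i\<in>{1..n} - I. (\<theta> i)\<^sup>2) + \<tau> * \<sigma>\<^sup>2 * ell n I) / \<sigma>\<^sup>2" for I
    using assms by (simp add: power_divide add_divide_distrib flip: sum_divide_distrib)
  show ?thesis
    unfolding is_oracle_def scale using J min by (auto intro: divide_right_mono)
qed

text \<open>Minimality of \<open>J\<close> is tested against \<open>I \<union> J\<close>, whose
  extra penalty is at most \<open>\<tau> * ell n I\<close> by subadditivity.\<close>

lemma is_oracle_sum_diff_le:
  assumes "is_oracle n \<tau> \<eta> J" "I \<subseteq> {1..n}" "0 \<le> \<tau>"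
  shows "(\<Sum>i\<in>I - J. (\<eta> i)\<^sup>2) \<le> \<tau> * ell n I"
proof -
  have fI: "finite I" using assms(2) finite_subset by blast
  have J: "J \<subseteq> {1..n}" using assms(1) by (simp add: is_oracle_def)
  have eq: "{1..n} - J = ({1..n} - (I \<union> J)) \<union> (I - J)" using assms(2) by auto
  have "(\<Sum>i\<in>{1..n} - J. (\<eta> i)\<^sup>2) = (\<Sum>i\<in>{1..n} - (I \<union> J). (\<eta> i)\<^sup>2) + (\<Sum>i\<in>I - J. (\<eta> i)\<^sup>2)"
    unfolding eq using fI by (intro sum.union_disjoint) auto
  moreover have "(\<Sum>i\<in>{1..n} - J. (\<eta> i)\<^sup>2) + \<tau> * ell n J \<le>
      (\<Sum>i\<in>{1..n} - (I \<union> J). (\<eta> i)\<^sup>2) + \<tau> * ell n (I \<union> J)"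
    using assms J by (simp add: is_oracle_def)
  moreover have "\<tau> * ell n (I \<union> J) \<le> \<tau> * (ell n I + ell n J)"
    using assms J ell_Un_le by (intro mult_left_mono) auto
  ultimately show ?thesis by (simp add: algebra_simps)
qed

text \<open>Minimality of \<open>J\<close> is tested against \<open>I \<inter> J\<close>, whose
  penalty is at most that of \<open>I\<close> by monotonicity.\<close>

lemma is_oracle_sum_diff_ge:
  assumes "is_oracle n \<tau> \<eta> J" "I \<subseteq> {1..n}" "0 \<le> \<tau>"
  shows "\<tau> * (ell n J - ell n I) \<le> (\<Sum>i\<in>J - I. (\<eta> i)\<^sup>2)"
proof -
  have J: "J \<subseteq> {1..n}" using assms(1) by (simp add: is_oracle_def)
  then have fJ: "finite J" using finite_subset by blast
  have eq: "{1..n} - (I \<inter> J) = ({1..n} - J) \<union> (J - I)" using J by auto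
  have "(\<Sum>i\<in>{1..n} - (I \<inter> J). (\<eta> i)\<^sup>2) = (\<Sum>i\<in>{1..n} - J. (\<eta> i)\<^sup>2) + (\<Sum>i\<in>J - I. (\<eta> i)\<^sup>2)"
    unfolding eq using fJ by (intro sum.union_disjoint) auto
  moreover have "(\<Sum>i\<in>{1..n} - J. (\<eta> i)\<^sup>2) + \<tau> * ell n J \<le>
      (\<Sum>i\<in>{1..n} - (I \<inter> J). (\<eta> i)\<^sup>2) + \<tau> * ell n (I \<inter> J)"
    using assms J by (simp add: is_oracle_def le_infI1)
  moreover have "\<tau> * ell n (I \<inter> J) \<le> \<tau> * ell n I"
    using assms ell_mono[of "I \<inter> J" I n] by (intro mult_left_mono) auto
  ultimately show ?thesis by (simp add: algebra_simps)
qed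

section \<open>The posterior as a Gibbs measure of the criterion\<close>

text \<open>On \<open>I\<close> each density is evaluated at its mean, and its variance is
  \<open>\<sigma>\<^sup>2 * (exp 1 * n / card I)\<close> because the \<open>- 1\<close> in
  \<open>Kn\<close> cancels. These coordinates together contribute
  \<open>exp (- ell n I / 2)\<close>; off \<open>I\<close> the density is that of pure
  noise.\<close>

lemma marginal_eq:
  assumes s: "0 < \<sigma>" and I: "I \<subseteq> {1..n}"
  shows "marginal n \<sigma> X I =
    (1 / sqrt (2 * pi * \<sigma>\<^sup>2)) ^ n * exp (- (ell n I + (\<Sum>i\<in>{1..n} - I. (X i / \<sigma>)\<^sup>2)) / 2)"
proof -
  define r where "r = exp 1 * real n / real (card I)"
  define c where "c = 1 / sqrt (2 * pi * \<sigma>\<^sup>2)"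
  have fin: "finite I" using I finite_subset by blast
  have in_I: "normal_density (X i * indicator I i) (sqrt (\<sigma>\<^sup>2 + tau2 n \<sigma> I i)) (X i) = c * exp (- ln r / 2)"
    if "i \<in> I" for i
  proof -
    have "I \<noteq> {}" using that by blast
    then have "0 < card I" "0 < n" using fin I by (auto simp: card_gt_0_iff)
    then have r: "0 < r" by (simp add: r_def)
    have t: "\<sigma>\<^sup>2 + tau2 n \<sigma> I i = \<sigma>\<^sup>2 * r"
      using that \<open>I \<noteq> {}\<close> by (simp add: tau2_def Kn_def r_def algebra_simps)
    have "exp (- ln r / 2) = r powr (- (1 / 2))" using r by (simp add: powr_def)
    also have "\<dots> = 1 / sqrt r" using r by (simp add: powr_minus powr_half_sqrt field_simps)
    finally show ?thesis
      using that r s unfolding t c_def normal_density_def by (simp add: real_sqrt_mult)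
  qed
  have notin_I: "normal_density (X i * indicator I i) (sqrt (\<sigma>\<^sup>2 + tau2 n \<sigma> I i)) (X i) = c * exp (- (X i / \<sigma>)\<^sup>2 / 2)"
    if "i \<notin> I" for i
    using that s by (simp add: normal_density_def tau2_def c_def power_divide)
  have "marginal n \<sigma> X I = (\<Prod>i\<in>{1..n}. c * (if i \<in> I then exp (- ln r / 2) else exp (- (X i / \<sigma>)\<^sup>2 / 2)))"
    unfolding marginal_def
  proof (intro prod.cong refl)
    fix i
    show "normal_density (X i * indicator I i) (sqrt (\<sigma>\<^sup>2 + tau2 n \<sigma> I i)) (X i) =
        c * (if i \<in> I then exp (- ln r / 2) else exp (- (X i / \<sigma>)\<^sup>2 / 2))"
      using in_I[of i] notin_I[of i] by (auto simp only: split: if_split)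
  qed
  also have "\<dots> = c ^ n * ((\<Prod>i\<in>I. exp (- ln r / 2)) * (\<Prod>i\<in>{1..n} - I. exp (- (X i / \<sigma>)\<^sup>2 / 2)))"
    using I by (simp add: prod.distrib prod.If_cases Int_absorb1 Diff_eq)
  also have "(\<Prod>i\<in>I. exp (- ln r / 2)) = exp (- ell n I / 2)"
    by (simp add: ell_def r_def flip: exp_of_nat_mult)
  also have "(\<Prod>i\<in>{1..n} - I. exp (- (X i / \<sigma>)\<^sup>2 / 2)) = exp (- (\<Sum>i\<in>{1..n} - I. (X i / \<sigma>)\<^sup>2) / 2)"
    by (subst exp_sum[symmetric]) (auto simp: sum_negf sum_divide_distrib)
  finally show ?thesis
    by (simp add: c_def add_divide_distrib flip: exp_add)
qed

lemma prior_weight_eq: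
  assumes "I \<subseteq> {1..n}"
  shows "prior_weight n \<kappa> I = exp (- \<kappa> * ell n I)"
proof (cases "I = {}")
  case False
  then have "0 < card I" "0 < n"
    using assms finite_subset[OF assms] by (auto simp: card_gt_0_iff)
  with False show ?thesis by (simp add: prior_weight_def powr_def ell_def mult_ac)
qed (simp add: prior_weight_def ell_def)

text \<open>The prior contributes \<open>\<kappa> * ell\<close> and the marginal
  \<open>ell / 2\<close> to the exponent, hence the penalty factor \<open>2 * \<kappa> + 1\<close>
  after doubling. The factors common to all sets cancel.\<close>

lemma post_eq:
  assumes s: "0 < \<sigma>" and I: "I \<subseteq> {1..n}"
  shows "post n \<sigma> \<kappa> X I = exp (- crit n \<kappa> (\<lambda>i. X i / \<sigma>) I / 2) /
    (\<Sum>J\<in>Pow {1..n}. exp (- crit n \<kappa> (\<lambda>i. X i / \<sigma>) J / 2))"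
proof -
  define C where "C = (1 / sqrt (2 * pi * \<sigma>\<^sup>2)) ^ n / (\<Sum>J\<in>Pow {1..n}. prior_weight n \<kappa> J)"
  have "0 < (\<Sum>J\<in>Pow {1..n}. prior_weight n \<kappa> J)"
    by (intro sum_pos) (auto simp: prior_weight_eq)
  then have C: "C \<noteq> 0" using s by (simp add: C_def)
  have pm: "prior n \<kappa> J * marginal n \<sigma> X J = C * exp (- crit n \<kappa> (\<lambda>i. X i / \<sigma>) J / 2)"
    if J: "J \<subseteq> {1..n}" for J
  proof -
    have "prior n \<kappa> J * marginal n \<sigma> X J =
        C * (exp (- \<kappa> * ell n J) * exp (- (ell n J + (\<Sum>i\<in>{1..n} - J. (X i / \<sigma>)\<^sup>2)) / 2))"
      unfolding marginal_eq[OF s J] prior_def prior_weight_eq[OF J] C_def by simp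
    also have "exp (- \<kappa> * ell n J) * exp (- (ell n J + (\<Sum>i\<in>{1..n} - J. (X i / \<sigma>)\<^sup>2)) / 2) =
        exp (- crit n \<kappa> (\<lambda>i. X i / \<sigma>) J / 2)"
      unfolding exp_add[symmetric] by (simp add: crit_def field_simps)
    finally show ?thesis .
  qed
  have "(\<Sum>J\<in>Pow {1..n}. prior n \<kappa> J * marginal n \<sigma> X J) =
      C * (\<Sum>J\<in>Pow {1..n}. exp (- crit n \<kappa> (\<lambda>i. X i / \<sigma>) J / 2))"
    unfolding sum_distrib_left by (intro sum.cong refl pm) auto
  with C show ?thesis by (simp add: post_def pm[OF I])
qed

lemma sum_exp_crit_pos: "0 < (\<Sum>J\<in>Pow {1..n}. exp (- crit n \<kappa> y J / 2))"
  by (intro sum_pos) auto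

lemma post_nonneg: "0 < \<sigma> \<Longrightarrow> I \<subseteq> {1..n} \<Longrightarrow> 0 \<le> post n \<sigma> \<kappa> X I"
  using sum_exp_crit_pos[of n \<kappa> "\<lambda>i. X i / \<sigma>"] by (simp add: post_eq)

lemma sum_post:
  assumes "0 < \<sigma>" shows "sum (post n \<sigma> \<kappa> X) (Pow {1..n}) = 1"
proof -
  have "sum (post n \<sigma> \<kappa> X) (Pow {1..n}) = (\<Sum>I\<in>Pow {1..n}. exp (- crit n \<kappa> (\<lambda>i. X i / \<sigma>) I / 2) /
    (\<Sum>J\<in>Pow {1..n}. exp (- crit n \<kappa> (\<lambda>i. X i / \<sigma>) J / 2)))"
    using assms by (intro sum.cong refl post_eq) auto
  then show ?thesis
    using sum_exp_crit_pos[of n \<kappa> "\<lambda>i. X i / \<sigma>"] by (simp flip: sum_divide_distrib)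
qed

text \<open>Only the term of the competitor \<open>J\<close> is kept in the normalizing sum, so the
  competitor may depend on \<open>I\<close>.\<close>

lemma post_le_exp_crit_diff:
  assumes "0 < \<sigma>" "I \<subseteq> {1..n}" "J \<subseteq> {1..n}"
  shows "post n \<sigma> \<kappa> X I \<le> exp (- (crit n \<kappa> (\<lambda>i. X i / \<sigma>) I - crit n \<kappa> (\<lambda>i. X i / \<sigma>) J) / 2)"
proof -
  let ?c = "crit n \<kappa> (\<lambda>i. X i / \<sigma>)"
  have "exp (- ?c J / 2) \<le> (\<Sum>J\<in>Pow {1..n}. exp (- ?c J / 2))"
    using assms(3) by (intro member_le_sum) auto
  then have "post n \<sigma> \<kappa> X I \<le> exp (- ?c I / 2) / exp (- ?c J / 2)"
    unfolding post_eq[OF assms(1,2)] by (intro divide_left_mono mult_pos_pos sum_exp_crit_pos) auto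
  also have "\<dots> = exp (- (?c I - ?c J) / 2)"
    unfolding exp_diff[symmetric] by (simp add: field_simps)
  finally show ?thesis .
qed

lemma eb_selector_subset:
  assumes "eb_selector n \<sigma> \<kappa> Ihat" "X \<in> space (Rn n)"
  shows "Ihat X \<subseteq> {1..n}"
  using assms by (auto simp: eb_selector_def is_arg_max_def)

lemma eb_selector_crit_le:
  assumes "eb_selector n \<sigma> \<kappa> Ihat" "X \<in> space (Rn n)" "0 < \<sigma>" "J \<subseteq> {1..n}"
  shows "crit n \<kappa> (\<lambda>i. X i / \<sigma>) (Ihat X) \<le> crit n \<kappa> (\<lambda>i. X i / \<sigma>) J"
proof -
  have sub: "Ihat X \<subseteq> {1..n}" using eb_selector_subset[OF assms(1,2)] .
  have "post n \<sigma> \<kappa> X J \<le> post n \<sigma> \<kappa> X (Ihat X)"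
    using assms unfolding eb_selector_def is_arg_max_linorder by blast
  then show ?thesis
    unfolding post_eq[OF assms(3,4)] post_eq[OF assms(3) sub]
    using sum_exp_crit_pos[of n \<kappa> "\<lambda>i. X i / \<sigma>"] by (simp add: divide_le_cancel)
qed

section \<open>Tail bounds for the noise\<close>

text \<open>In the threshold, \<open>B\<close> pays for the exponential moment, \<open>a\<close> is
  what remains for a union bound over sets, and \<open>M\<close> sets the probability.\<close>

definition excess_noise :: "nat \<Rightarrow> real \<Rightarrow> real \<Rightarrow> real \<Rightarrow> real \<Rightarrow> nat set \<Rightarrow> (nat \<Rightarrow> real) set" where
  "excess_noise n \<beta> B a M I =
     {\<xi> \<in> space (Rn n). \<beta> * (\<Sum>i\<in>I. (\<xi> i)\<^sup>2) \<ge> (B + a) * ell n I + M}"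

lemma excess_noise_sets:
  assumes "I \<subseteq> {1..n}" shows "excess_noise n \<beta> B a M I \<in> sets (Rn n)"
proof -
  have [measurable]: "(\<lambda>\<xi>. \<xi> i) \<in> borel_measurable (Rn n)" if "i \<in> I" for i
    using that assms by (intro measurable_component_singleton) auto
  show ?thesis unfolding excess_noise_def by measurable
qed

text \<open>A Chernoff bound: Markov's inequality for the exponential moment on \<open>I\<close>,
  with \<open>B * card I\<close> enlarged to \<open>B * ell n I\<close>.\<close>

lemma measure_excess_noise_le:
  assumes Q: "noise_law n Q" "exch_exp_moment n \<beta> B Q" and B: "0 \<le> B" and I: "I \<subseteq> {1..n}"
  shows "measure Q (excess_noise n \<beta> B a M I) \<le> exp (- a * ell n I) * exp (- M)"
proof -
  interpret prob_space Q using Q(1) by (simp add: noise_law_def)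
  have sets [measurable_cong]: "sets Q = sets (Rn n)" using Q(1) by (simp add: noise_law_def)
  then have space: "space Q = space (Rn n)" by (rule sets_eq_imp_space_eq)
  have [measurable]: "(\<lambda>\<xi>. \<xi> i) \<in> borel_measurable Q" if "i \<in> I" for i
    unfolding measurable_cong_sets[OF sets refl]
    using that I by (intro measurable_component_singleton) auto
  let ?f = "\<lambda>\<xi>. ennreal (exp (\<beta> * (\<Sum>i\<in>I. (\<xi> i)\<^sup>2)))"
  let ?c = "exp (- ((B + a) * ell n I + M))"
  have "emeasure Q (excess_noise n \<beta> B a M I) =
      emeasure Q ({\<xi> \<in> space Q. 1 \<le> ennreal ?c * ?f \<xi>} \<inter> space Q)"
    unfolding excess_noise_def space
    by (intro arg_cong[where f="emeasure Q"]) (auto simp flip: ennreal_mult exp_add)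
  also have "\<dots> \<le> ennreal ?c * (\<integral>\<^sup>+ \<xi>. ?f \<xi> * indicator (space Q) \<xi> \<partial>Q)"
    by (rule order_trans[OF _ nn_integral_Markov_inequality]) (auto intro!: emeasure_mono)
  also have "(\<integral>\<^sup>+ \<xi>. ?f \<xi> * indicator (space Q) \<xi> \<partial>Q) = (\<integral>\<^sup>+ \<xi>. ?f \<xi> \<partial>Q)"
    by (intro nn_integral_cong) auto
  also have "\<dots> \<le> ennreal (exp (B * real (card I)))"
    using Q(2) I by (simp add: exch_exp_moment_def)
  also have "\<dots> \<le> ennreal (exp (B * ell n I))"
    using card_le_ell[OF I] B by (intro ennreal_leI) (auto intro: mult_left_mono)
  also have "ennreal ?c * ennreal (exp (B * ell n I)) = ennreal (exp (- a * ell n I) * exp (- M))"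
    unfolding ennreal_mult'[symmetric, OF exp_ge_zero] exp_add[symmetric] by (simp add: algebra_simps)
  finally show ?thesis
    by (simp add: emeasure_eq_measure mult_left_mono)
qed

lemma measure_Union_excess_noise_le:
  assumes Q: "noise_law n Q" "exch_exp_moment n \<beta> B Q" and B: "0 \<le> B" and a: "0 < a"
  shows "measure Q (\<Union>I\<in>Pow {1..n}. excess_noise n \<beta> B (1 + a) M I) \<le> 1 / (1 - exp (- a)) * exp (- M)"
proof -
  interpret prob_space Q using Q(1) by (simp add: noise_law_def)
  have sets: "sets Q = sets (Rn n)" using Q(1) by (simp add: noise_law_def)
  have "measure Q (\<Union>I\<in>Pow {1..n}. excess_noise n \<beta> B (1 + a) M I) \<le>
      (\<Sum>I\<in>Pow {1..n}. measure Q (excess_noise n \<beta> B (1 + a) M I))"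
    using excess_noise_sets
    by (intro finite_measure_subadditive_finite) (auto simp: sets simp del: One_nat_def)
  also have "\<dots> \<le> (\<Sum>I\<in>Pow {1..n}. exp (- (1 + a) * ell n I) * exp (- M))"
    by (intro sum_mono measure_excess_noise_le[OF Q B]) auto
  also have "\<dots> \<le> 1 / (1 - exp (- a)) * exp (- M)"
    unfolding sum_distrib_right[symmetric] by (intro mult_right_mono sum_exp_neg_ell_le a) auto
  finally show ?thesis .
qed

lemma measure_obs_law_le:
  assumes Q: "noise_law n Q" and A: "A \<in> sets Q" and "measure Q A \<le> p"
    and sub: "\<And>\<xi>. \<xi> \<in> space (Rn n) \<Longrightarrow> \<xi> \<notin> A \<Longrightarrow> (\<lambda>i\<in>{1..n}. \<theta> i + \<sigma> * \<xi> i) \<notin> S"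
  shows "measure (obs_law n \<sigma> Q \<theta>) S \<le> p"
proof (cases "S \<in> sets (Rn n)")
  case True
  interpret prob_space Q using Q by (simp add: noise_law_def)
  have sets [measurable_cong]: "sets Q = sets (Rn n)" using Q by (simp add: noise_law_def)
  then have space: "space Q = space (Rn n)" by (rule sets_eq_imp_space_eq)
  have "(\<lambda>\<xi>. \<lambda>i\<in>{1..n}. \<theta> i + \<sigma> * \<xi> i) \<in> Q \<rightarrow>\<^sub>M Rn n"
    by measurable
  then have "measure (obs_law n \<sigma> Q \<theta>) S = measure Q ((\<lambda>\<xi>. \<lambda>i\<in>{1..n}. \<theta> i + \<sigma> * \<xi> i) -` S \<inter> space Q)"
    unfolding obs_law_def using True by (rule measure_distr)
  also have "\<dots> \<le> measure Q A"
    using sub space by (intro finite_measure_mono A) auto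
  finally show ?thesis using assms(3) by linarith
next
  \<comment> \<open>A set that is not measurable has \<open>measure\<close> 0 by default.\<close>
  case False
  then have "measure (obs_law n \<sigma> Q \<theta>) S = 0"
    by (intro measure_notin_sets) (simp add: obs_law_def)
  then show ?thesis using assms(3) measure_nonneg[of Q A] by linarith
qed

section \<open>Size of a minimizer and averages over a posterior\<close>

text \<open>The squared error, in units of \<open>\<sigma>\<^sup>2\<close>, of keeping the
  coordinates in \<open>I\<close>: noise where they are kept, bias where they are dropped.\<close>

definition loss :: "nat \<Rightarrow> (nat \<Rightarrow> real) \<Rightarrow> (nat \<Rightarrow> real) \<Rightarrow> nat set \<Rightarrow> real" where
  "loss n \<eta> \<xi> I = (\<Sum>i\<in>I. (\<xi> i)\<^sup>2) + (\<Sum>i\<in>{1..n} - I. (\<eta> i)\<^sup>2)"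

text \<open>Signal and noise on \<open>I\<close> use up at most \<open>2 * b + 5 / 2 * u + 2\<close>
  of the penalty factor \<open>2 * \<kappa> + 1\<close>, and at least \<open>2 * u\<close> is left.
  Dividing by \<open>2 * u\<close> gives \<open>M\<close> the coefficient 1, hence the rate
  \<open>exp (- M)\<close>.\<close>

lemma ell_less_of_crit_le:
  assumes "I \<subseteq> {1..n}" and y: "\<And>i. i \<in> {1..n} \<Longrightarrow> y i = \<eta> i + \<xi> i"
    and "is_oracle n 1 \<eta> J" "crit n \<kappa> y I \<le> crit n \<kappa> y J"
    and noise: "(\<Sum>i\<in>I. (\<xi> i)\<^sup>2) < (b + 5 / 4 * u) * ell n I + u * M"
    and u: "1 \<le> u" and \<kappa>: "6 * u + 2 * b + 1 / 2 \<le> 2 * \<kappa> + 1" "0 \<le> \<kappa>"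
  shows "ell n I < (2 * \<kappa> + 1) * ell n J + M"
proof -
  define e f where "e = ell n I" and "f = ell n J"
  have e: "0 \<le> e" using ell_nonneg[OF assms(1)] by (simp add: e_def)
  have f: "0 \<le> f" using ell_nonneg assms(3) by (simp add: f_def is_oracle_def)
  have "(2 * \<kappa> + 1) * (e - f) \<le> 2 * (\<Sum>i\<in>I. (\<xi> i)\<^sup>2) + 2 * (\<Sum>i\<in>I - J. (\<eta> i)\<^sup>2)"
    using crit_diff_ge[where y = y and \<eta> = \<eta> and \<xi> = \<xi> and J = J and \<kappa> = \<kappa>, OF assms(1) y] assms(4) by (simp add: e_def f_def)
  also have "(\<Sum>i\<in>I - J. (\<eta> i)\<^sup>2) \<le> e"
    using is_oracle_sum_diff_le[OF assms(3,1)] by (simp add: e_def)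
  finally have "(2 * \<kappa> + 1) * e < (2 * \<kappa> + 1) * f + (2 * b + 5 / 2 * u + 2) * e + 2 * u * M"
    using noise by (simp add: e_def[symmetric] algebra_simps)
  moreover have "(6 * u + 2 * b + 1 / 2) * e \<le> (2 * \<kappa> + 1) * e"
    using \<kappa>(1) e by (rule mult_right_mono)
  \<comment> \<open>What is left of the penalty factor is at least \<open>7 / 2 * u - 3 / 2\<close>;
    this is at least \<open>2 * u\<close> since \<open>u \<ge> 1\<close>.\<close>
  moreover have "1 * e \<le> u * e" using u e by (rule mult_right_mono)
  moreover have "1 * ((2 * \<kappa> + 1) * f) \<le> (2 * u) * ((2 * \<kappa> + 1) * f)"
    using u f \<kappa>(2) by (intro mult_right_mono mult_nonneg_nonneg) auto
  ultimately have "(2 * u) * e < (2 * u) * ((2 * \<kappa> + 1) * f + M)"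
    by (simp add: algebra_simps)
  then show ?thesis using u by (simp add: e_def f_def)
qed

text \<open>Where \<open>q I \<le> \<Lambda>\<close>, the weights sum to at most 1. Where
  \<open>q I\<close> exceeds \<open>\<Lambda>\<close> by \<open>x\<close>, the weight is at most
  \<open>exp (- e I - x)\<close>, and \<open>x \<le> exp x\<close> bounds its share by
  \<open>exp (- e I)\<close>.\<close>

lemma sum_weights_le:
  fixes w P R q e :: "'a \<Rightarrow> real" and \<Lambda> :: real
  assumes "\<And>I. I \<in> A \<Longrightarrow> 0 \<le> w I" "sum w A = 1"
    and "\<And>I. I \<in> A \<Longrightarrow> w I \<le> exp (- P I / 2)" "\<And>I. I \<in> A \<Longrightarrow> w I \<le> exp (- R I / 2)"
    and v: "\<And>I. I \<in> A \<Longrightarrow> e I + q I - \<Lambda> \<le> (3 * P I + R I) / 8"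
  shows "(\<Sum>I\<in>A. w I * q I) \<le> \<Lambda> + (\<Sum>I\<in>A. exp (- e I))"
proof -
  have "w I * q I \<le> \<Lambda> * w I + exp (- e I)" if I: "I \<in> A" for I
  proof (cases "q I \<le> \<Lambda>")
    case True
    then have "w I * q I \<le> w I * \<Lambda>" using assms(1)[OF I] by (rule mult_left_mono)
    then show ?thesis using exp_ge_zero[of "- e I"] by (simp add: mult.commute add_increasing2)
  next
    case False
    define x where "x = q I - \<Lambda>"
    have x: "0 < x" using False by (simp add: x_def)
    \<comment> \<open>The larger of \<open>P I\<close> and \<open>R I\<close> is at least their
      convex combination with weights 3/4 and 1/4.\<close>
    have "w I \<le> exp (- ((3 * P I + R I) / 8))"
    proof (cases "P I \<le> R I")
      case True
      then have "exp (- R I / 2) \<le> exp (- ((3 * P I + R I) / 8))" by simp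
      then show ?thesis using assms(4)[OF I] by linarith
    next
      case False
      then have "exp (- P I / 2) \<le> exp (- ((3 * P I + R I) / 8))" by simp
      then show ?thesis using assms(3)[OF I] by linarith
    qed
    also have "\<dots> \<le> exp (- e I - x)" using v[OF I] unfolding exp_le_cancel_iff x_def by linarith
    also have "\<dots> = exp (- e I) / exp x" by (simp add: exp_diff)
    finally have "w I * x \<le> exp (- e I) / exp x * x" using x by (intro mult_right_mono) auto
    also have "\<dots> = exp (- e I) * (x / exp x)" by simp
    also have "\<dots> \<le> exp (- e I) * 1"
      using exp_gt_self[of x] by (intro mult_left_mono) (auto simp: divide_le_eq)
    finally show ?thesis by (simp add: x_def algebra_simps)
  qed
  then have "(\<Sum>I\<in>A. w I * q I) \<le> (\<Sum>I\<in>A. \<Lambda> * w I + exp (- e I))" by (rule sum_mono)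
  also have "\<dots> = \<Lambda> + (\<Sum>I\<in>A. exp (- e I))"
    by (simp add: sum.distrib assms(2) flip: sum_distrib_left)
  finally show ?thesis .
qed

section \<open>Deterministic risk bounds on the good event\<close>

text \<open>The first factor bounds the loss by a multiple of
  \<open>(t + 1) * (1 + ell n J + M)\<close>; the second is the price of replacing the unknown
  \<open>J\<close> by the selected set.\<close>

definition risk_const :: "real \<Rightarrow> real \<Rightarrow> real \<Rightarrow> real \<Rightarrow> real" where
  "risk_const \<kappa> u b \<tau>0 =
    ((4 * b + 5 * u + 12) * (1 / (1 - exp (- 1 / 4)) + 4 * u + 2 * b + 4 * \<kappa> + 4) + u + 1) *
    (1 + (\<tau>0 + 3 * u) / (\<tau>0 - (3 * \<kappa> + 3 / 2 + 3 * b)))"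

lemma risk_const_pos:
  assumes "0 \<le> u" "0 \<le> b" "0 \<le> \<kappa>" "3 * \<kappa> + 3 / 2 + 3 * b < \<tau>0"
  shows "0 < risk_const \<kappa> u b \<tau>0"
proof -
  have "0 \<le> \<tau>0" using assms by linarith
  then show ?thesis
    unfolding risk_const_def using assms
    by (intro mult_pos_pos add_nonneg_pos add_pos_nonneg mult_nonneg_nonneg divide_nonneg_nonneg) auto
qed

text \<open>In this locale \<open>u = 1 / \<beta>\<close>, \<open>b = B / \<beta>\<close>, the scale is \<open>\<sigma> = 1\<close> and \<open>J\<close> plays the role of
  \<open>I\<^sub>*\<close>. The noise on the single set \<open>J\<close> is bounded without the term \<open>5 / 4 * u\<close> that the union
  bound over all sets costs; this is what makes \<open>\<tau>0 > 3 * \<kappa> + 3 / 2 + 3 * b\<close> sufficient.\<close>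

locale good_event =
  fixes n :: nat and \<kappa> u b \<tau>0 t M :: real and y \<eta> \<xi> :: "nat \<Rightarrow> real" and J :: "nat set"
  assumes u: "1 \<le> u" and b: "0 \<le> b" and t: "0 \<le> t" and M: "0 \<le> M" and \<kappa>_nonneg: "0 \<le> \<kappa>"
    and \<kappa>: "6 * u + 2 * b + 1 / 2 \<le> 2 * \<kappa> + 1"
    and \<tau>0: "3 * \<kappa> + 3 / 2 + 3 * b < \<tau>0"
    and y: "\<And>i. i \<in> {1..n} \<Longrightarrow> y i = \<eta> i + \<xi> i"
    and noise: "\<And>I. I \<subseteq> {1..n} \<Longrightarrow> (\<Sum>i\<in>I. (\<xi> i)\<^sup>2) \<le> (b + 5 / 4 * u) * ell n I + u * M"
    and noise_J: "(\<Sum>i\<in>J. (\<xi> i)\<^sup>2) \<le> b * ell n J + u * M"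
    and J_oracle: "is_oracle n \<tau>0 \<eta> J"
    and bias: "(\<Sum>i\<in>{1..n} - J. (\<eta> i)\<^sup>2) \<le> t * (1 + ell n J)"
begin

lemma J_subset: "J \<subseteq> {1..n}"
  using J_oracle by (simp add: is_oracle_def)

text \<open>The weights are what the two comparisons leave: 1/12 is 1/8 of the factor 2/3 in
  \<open>crit_diff_Un_J_ge\<close>, and 1/4 is 3/8 of the factor 4 in \<open>crit_diff_J_ge\<close>,
  less the 5/4 spent on summing over all sets.\<close>

abbreviation q where "q I \<equiv> ell n I / 4 + (\<Sum>i\<in>J - I. (\<eta> i)\<^sup>2) / 12"

text \<open>\<open>L1\<close> and \<open>L2\<close> are the slacks in the comparisons of
  \<open>I\<close> with \<open>J\<close> and with \<open>I \<union> J\<close>; \<open>L\<close>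
  combines them with the weights 3/8 and 1/8 from \<open>sum_weights_le\<close>.\<close>

definition "L1 = 2 * u * M + 2 * t * (1 + ell n J) + (2 * \<kappa> + 1) * ell n J"

definition "L2 = 2 * (b * ell n J + u * M) + (2 * \<kappa> + 1) * ell n J"

definition "L = 3 / 8 * L1 + L2 / 8"

lemma L_nonneg: "0 \<le> L1" "0 \<le> L2"
  using u b t M \<kappa>_nonneg ell_nonneg[OF J_subset] by (simp_all add: L1_def L2_def)

text \<open>As \<open>I - J\<close> lies outside \<open>J\<close>, its signal is bounded by
  \<open>bias\<close>. The noise leaves at least \<open>7 / 2 * u + 1 / 2 \<ge> 4\<close> of the
  penalty factor.\<close>

lemma crit_diff_J_ge:
  assumes "I \<subseteq> {1..n}"
  shows "4 * ell n I - L1 \<le> crit n \<kappa> y I - crit n \<kappa> y J"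
proof -
  have e: "0 \<le> ell n I" using ell_nonneg[OF assms] .
  have "(\<Sum>i\<in>I - J. (\<eta> i)\<^sup>2) \<le> (\<Sum>i\<in>{1..n} - J. (\<eta> i)\<^sup>2)"
    using assms by (intro sum_mono2) auto
  also note bias
  finally have *: "(\<Sum>i\<in>I - J. (\<eta> i)\<^sup>2) \<le> t * (1 + ell n J)" .
  have "(6 * u + 2 * b + 1 / 2) * ell n I \<le> (2 * \<kappa> + 1) * ell n I"
    using \<kappa> e by (rule mult_right_mono)
  moreover have "1 * ell n I \<le> u * ell n I" using u e by (rule mult_right_mono)
  ultimately show ?thesis
    using crit_diff_ge[where y = y and \<eta> = \<eta> and \<xi> = \<xi> and J = J and \<kappa> = \<kappa>, OF assms y] * noise[OF assms]
    by (simp add: L1_def algebra_simps)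
qed

lemma crit_diff_Un_J_ge:
  assumes "I \<subseteq> {1..n}"
  shows "2 / 3 * (\<Sum>i\<in>J - I. (\<eta> i)\<^sup>2) - L2 \<le> crit n \<kappa> y I - crit n \<kappa> y (I \<union> J)"
  using crit_diff_Un_ge[where y = y and \<eta> = \<eta> and \<xi> = \<xi>, OF assms J_subset y \<kappa>_nonneg] noise_J by (simp add: L2_def)

text \<open>Signal missed by \<open>I\<close> lies outside \<open>J\<close>, where
  \<open>bias\<close> bounds it, or on \<open>J - I\<close>. The factor
  \<open>4 * b + 5 * u + 12\<close> covers both the noise factor \<open>b + 5 / 4 * u\<close> of
  \<open>ell n I / 4\<close> and the factor 12 of the signal on \<open>J - I\<close>.\<close>

lemma loss_le:
  assumes "I \<subseteq> {1..n}"
  shows "loss n \<eta> \<xi> I \<le> (4 * b + 5 * u + 12) * q I + u * M + t * (1 + ell n J)"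
proof -
  define Y where "Y = (\<Sum>i\<in>J - I. (\<eta> i)\<^sup>2)"
  have Y: "0 \<le> Y" by (simp add: Y_def sum_nonneg)
  have e: "0 \<le> ell n I" using ell_nonneg[OF assms] .
  have fJ: "finite J" using J_subset finite_subset by blast
  have "(\<Sum>i\<in>{1..n} - I. (\<eta> i)\<^sup>2) \<le> (\<Sum>i\<in>({1..n} - J) \<union> (J - I). (\<eta> i)\<^sup>2)"
    using fJ by (intro sum_mono2) auto
  also have "\<dots> = (\<Sum>i\<in>{1..n} - J. (\<eta> i)\<^sup>2) + Y"
    unfolding Y_def using fJ by (intro sum.union_disjoint) auto
  finally have "loss n \<eta> \<xi> I \<le> (b + 5 / 4 * u) * ell n I + u * M + (t * (1 + ell n J) + Y)"
    using bias noise[OF assms] by (simp add: loss_def)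
  moreover have "0 \<le> (4 * b + 5 * u) * (Y / 12) + 3 * ell n I"
    using Y e u b by simp
  ultimately show ?thesis unfolding Y_def[symmetric] by (simp add: algebra_simps)
qed

lemma loss_weighted_le:
  assumes w: "\<And>I. I \<in> Pow {1..n} \<Longrightarrow> 0 \<le> w I" "sum w (Pow {1..n}) = 1"
    and le: "\<And>I K. I \<subseteq> {1..n} \<Longrightarrow> K \<subseteq> {1..n} \<Longrightarrow> w I \<le> exp (- (crit n \<kappa> y I - crit n \<kappa> y K) / 2)"
  shows "(\<Sum>I\<in>Pow {1..n}. w I * loss n \<eta> \<xi> I) \<le>
    (4 * b + 5 * u + 12) * (L + 1 / (1 - exp (- 1 / 4))) + u * M + t * (1 + ell n J)"
proof -
  let ?D = "4 * b + 5 * u + 12" and ?c = "u * M + t * (1 + ell n J)"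
  have "(\<Sum>I\<in>Pow {1..n}. w I * q I) \<le> L + (\<Sum>I\<in>Pow {1..n}. exp (- (5 / 4 * ell n I)))"
  proof (rule sum_weights_le[OF w])
    fix I assume "I \<in> Pow {1..n}"
    then have I: "I \<subseteq> {1..n}" by simp
    show "w I \<le> exp (- (crit n \<kappa> y I - crit n \<kappa> y J) / 2)"
      using le[OF I J_subset] .
    show "w I \<le> exp (- (crit n \<kappa> y I - crit n \<kappa> y (I \<union> J)) / 2)"
      using le I J_subset by simp
    \<comment> \<open>The exponent 5/4 is \<open>1 + a\<close> with \<open>a = 1 / 4\<close> in
      \<open>sum_exp_neg_ell_le\<close>.\<close>
    show "5 / 4 * ell n I + q I - L \<le>
        (3 * (crit n \<kappa> y I - crit n \<kappa> y J) + (crit n \<kappa> y I - crit n \<kappa> y (I \<union> J))) / 8"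
      using crit_diff_J_ge[OF I] crit_diff_Un_J_ge[OF I] by (simp add: L_def field_simps)
  qed
  also have "(\<Sum>I\<in>Pow {1..n}. exp (- (5 / 4 * ell n I))) \<le> 1 / (1 - exp (- 1 / 4))"
    using sum_exp_neg_ell_le[of "1 / 4" n] by simp
  finally have *: "(\<Sum>I\<in>Pow {1..n}. w I * q I) \<le> L + 1 / (1 - exp (- 1 / 4))" by simp
  have "(\<Sum>I\<in>Pow {1..n}. w I * loss n \<eta> \<xi> I) \<le> (\<Sum>I\<in>Pow {1..n}. w I * (?D * q I + ?c))"
    using w(1) loss_le by (intro sum_mono mult_left_mono) (auto simp: algebra_simps)
  also have "\<dots> = (\<Sum>I\<in>Pow {1..n}. ?D * (w I * q I) + ?c * w I)"
    by (intro sum.cong) (auto simp: algebra_simps)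
  also have "\<dots> = ?D * (\<Sum>I\<in>Pow {1..n}. w I * q I) + ?c"
    by (simp only: sum.distrib sum_distrib_left[symmetric] w(2) mult_1_right)
  also have "\<dots> \<le> ?D * (L + 1 / (1 - exp (- 1 / 4))) + ?c"
    using * u b by (intro add_right_mono mult_left_mono) auto
  finally show ?thesis by simp
qed

text \<open>At a minimizer both increments of the criterion are at most 0, so
  \<open>q I \<le> L\<close> holds outright. The geometric series constant is added to share one
  bound with the average.\<close>

lemma loss_minimizer_le:
  assumes I: "I \<subseteq> {1..n}" and min: "\<And>K. K \<subseteq> {1..n} \<Longrightarrow> crit n \<kappa> y I \<le> crit n \<kappa> y K"
  shows "loss n \<eta> \<xi> I \<le>
    (4 * b + 5 * u + 12) * (L + 1 / (1 - exp (- 1 / 4))) + u * M + t * (1 + ell n J)"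
proof -
  have "q I \<le> L"
    using crit_diff_J_ge[OF I] crit_diff_Un_J_ge[OF I] min[OF J_subset] min[of "I \<union> J"] I J_subset L_nonneg
    by (simp add: L_def)
  also have "L \<le> L + 1 / (1 - exp (- 1 / 4))" by simp
  finally have "(4 * b + 5 * u + 12) * q I \<le> (4 * b + 5 * u + 12) * (L + 1 / (1 - exp (- 1 / 4)))"
    using u b by (intro mult_left_mono) auto
  then show ?thesis using loss_le[OF I] by linarith
qed

text \<open>The oracle property bounds the signal on \<open>J - I\<close> from below, the criterion
  bounds it from above. The upper bound contains \<open>ell n J\<close> with a factor smaller than
  \<open>\<tau>0\<close>, so it can be absorbed; this lets an observable radius cover the unknown
  complexity.\<close>

lemma ell_J_le:
  assumes I: "I \<subseteq> {1..n}" and min: "\<And>K. K \<subseteq> {1..n} \<Longrightarrow> crit n \<kappa> y I \<le> crit n \<kappa> y K"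
  shows "(\<tau>0 - (3 * \<kappa> + 3 / 2 + 3 * b)) * ell n J \<le> \<tau>0 * ell n I + 3 * u * M"
proof -
  have "0 \<le> \<tau>0" using \<tau>0 \<kappa>_nonneg b by linarith
  then have "\<tau>0 * (ell n J - ell n I) \<le> (\<Sum>i\<in>J - I. (\<eta> i)\<^sup>2)"
    by (rule is_oracle_sum_diff_ge[OF J_oracle I])
  also have "\<dots> \<le> 3 / 2 * L2"
    using crit_diff_Un_J_ge[OF I] min[of "I \<union> J"] I J_subset by simp
  finally show ?thesis by (simp add: L2_def algebra_simps)
qed

lemma loss_bound_le:
  assumes I: "I \<subseteq> {1..n}" and min: "\<And>K. K \<subseteq> {1..n} \<Longrightarrow> crit n \<kappa> y I \<le> crit n \<kappa> y K"
  shows "(4 * b + 5 * u + 12) * (L + 1 / (1 - exp (- 1 / 4))) + u * M + t * (1 + ell n J) \<le>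
    risk_const \<kappa> u b \<tau>0 * (t + 1) * (1 + ell n I + M)"
proof -
  define K where "K = 1 / (1 - exp (- 1 / 4 :: real))"
  define D where "D = 4 * b + 5 * u + 12"
  define C1 where "C1 = D * (K + 4 * u + 2 * b + 4 * \<kappa> + 4) + u + 1"
  define C2 where "C2 = 1 + (\<tau>0 + 3 * u) / (\<tau>0 - (3 * \<kappa> + 3 / 2 + 3 * b))"
  define e where "e = ell n J"
  \<comment> \<open>A common majorant of \<open>1\<close>, \<open>M\<close>, \<open>ell n J\<close>
    and \<open>t * (1 + ell n J)\<close>.\<close>
  define G where "G = (t + 1) * (1 + e + M)"
  have e: "0 \<le> e" using ell_nonneg[OF J_subset] by (simp add: e_def)
  have K: "0 \<le> K" by (simp add: K_def)
  have D: "0 \<le> D" using u b by (simp add: D_def)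
  have te: "0 \<le> t * e" "0 \<le> t * M" using t e M by auto
  then have "1 \<le> G" "M \<le> G" "e \<le> G" and tG: "t * (1 + e) \<le> G"
    using t e M by (auto simp: G_def algebra_simps)
  then have G: "K \<le> K * G" "u * M \<le> u * G" "b * e \<le> b * G" "(2 * \<kappa> + 1) * e \<le> (2 * \<kappa> + 1) * G"
    using mult_left_mono[of 1 G K] K u b \<kappa>_nonneg by (auto intro!: mult_left_mono)
  \<comment> \<open>With the weights given up, \<open>4 * u\<close> collects the two terms
    \<open>2 * u * M\<close>, and \<open>4 * \<kappa> + 4\<close> collects the two penalties and the
    factor 2 of the bias.\<close>
  have "L \<le> L1 + L2" using L_nonneg by (simp add: L_def)
  then have "L + K \<le> (K + 4 * u + 2 * b + 4 * \<kappa> + 4) * G"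
    using G tG by (simp add: L1_def L2_def flip: e_def) (simp add: algebra_simps)
  then have "D * (L + K) \<le> D * ((K + 4 * u + 2 * b + 4 * \<kappa> + 4) * G)"
    using D by (rule mult_left_mono)
  then have "D * (L + K) + u * M + t * (1 + e) \<le> C1 * G"
    using G(2) tG unfolding C1_def by (simp add: algebra_simps)
  also have "C1 * G \<le> C1 * ((t + 1) * (C2 * (1 + ell n I + M)))"
  proof -
    define d where "d = \<tau>0 - (3 * \<kappa> + 3 / 2 + 3 * b)"
    define f where "f = ell n I"
    have d: "0 < d" using \<tau>0 by (simp add: d_def)
    have f: "0 \<le> f" using ell_nonneg[OF I] by (simp add: f_def)
    have \<tau>0_nonneg: "0 \<le> \<tau>0" using \<tau>0 \<kappa>_nonneg b by linarith
    have "d * e \<le> \<tau>0 * f + 3 * u * M"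
      using ell_J_le[OF I min] by (simp add: d_def e_def f_def)
    also have "\<dots> \<le> (\<tau>0 + 3 * u) * (1 + f + M)"
      using \<tau>0_nonneg u f M by (simp add: algebra_simps)
    finally have "e \<le> (\<tau>0 + 3 * u) / d * (1 + f + M)"
      using d by (simp add: field_simps)
    then have "1 + e + M \<le> C2 * (1 + f + M)"
      using f unfolding C2_def d_def[symmetric] by (simp add: algebra_simps)
    moreover have "0 \<le> C1"
      using D K u b \<kappa>_nonneg unfolding C1_def D_def[symmetric] K_def[symmetric] by simp
    ultimately show ?thesis
      unfolding G_def f_def[symmetric] using t by (intro mult_left_mono) auto
  qed
  also have "\<dots> = risk_const \<kappa> u b \<tau>0 * (t + 1) * (1 + ell n I + M)"
    unfolding risk_const_def C1_def C2_def K_def D_def by (simp add: mult_ac)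
  finally show ?thesis unfolding K_def D_def e_def .
qed

end

section \<open>From the loss to the error of the two estimators\<close>

lemma sum_coord_part_error:
  assumes "0 < \<sigma>" "I \<subseteq> {1..n}" and X: "\<And>i. i \<in> {1..n} \<Longrightarrow> X i = \<theta> i + \<sigma> * \<xi> i"
  shows "(\<Sum>i\<in>{1..n}. (coord_part n X I i - \<theta> i)\<^sup>2) = \<sigma>\<^sup>2 * loss n (\<lambda>i. \<theta> i / \<sigma>) \<xi> I"
proof -
  have fI: "finite I" using assms(2) finite_subset by blast
  have "(\<Sum>i\<in>{1..n}. (coord_part n X I i - \<theta> i)\<^sup>2) =
      (\<Sum>i\<in>I \<union> ({1..n} - I). (coord_part n X I i - \<theta> i)\<^sup>2)"
    using assms(2) by (intro sum.cong) auto
  also have "\<dots> = (\<Sum>i\<in>I. (coord_part n X I i - \<theta> i)\<^sup>2) +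
      (\<Sum>i\<in>{1..n} - I. (coord_part n X I i - \<theta> i)\<^sup>2)"
    using fI by (intro sum.union_disjoint) auto
  also have "(\<Sum>i\<in>I. (coord_part n X I i - \<theta> i)\<^sup>2) = (\<Sum>i\<in>I. \<sigma>\<^sup>2 * (\<xi> i)\<^sup>2)"
    using assms(2) X by (intro sum.cong) (auto simp: coord_part_def power_mult_distrib subset_iff)
  also have "(\<Sum>i\<in>{1..n} - I. (coord_part n X I i - \<theta> i)\<^sup>2) = (\<Sum>i\<in>{1..n} - I. \<sigma>\<^sup>2 * (\<theta> i / \<sigma>)\<^sup>2)"
    using assms(1) by (intro sum.cong) (auto simp: coord_part_def power_divide)
  finally show ?thesis by (simp add: loss_def sum_distrib_left distrib_left)
qed

text \<open>The estimator is the posterior average of the \<open>coord_part n X I\<close>; Jensen's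
  inequality in each coordinate, then an exchange of sums.\<close>

lemma theta_tilde_error_le:
  assumes "0 < \<sigma>" and X: "\<And>i. i \<in> {1..n} \<Longrightarrow> X i = \<theta> i + \<sigma> * \<xi> i"
  shows "(\<Sum>i\<in>{1..n}. (theta_tilde n \<sigma> \<kappa> X i - \<theta> i)\<^sup>2) \<le>
    \<sigma>\<^sup>2 * (\<Sum>I\<in>Pow {1..n}. post n \<sigma> \<kappa> X I * loss n (\<lambda>i. \<theta> i / \<sigma>) \<xi> I)"
proof -
  let ?p = "post n \<sigma> \<kappa> X"
  have "(theta_tilde n \<sigma> \<kappa> X i - \<theta> i)\<^sup>2 \<le> (\<Sum>I\<in>Pow {1..n}. ?p I * (coord_part n X I i - \<theta> i)\<^sup>2)"
    if i: "i \<in> {1..n}" for i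
  proof -
    have "theta_tilde n \<sigma> \<kappa> X i - \<theta> i =
        (\<Sum>I\<in>Pow {1..n}. coord_part n X I i * ?p I) - \<theta> i * (\<Sum>I\<in>Pow {1..n}. ?p I)"
      using i sum_post[OF assms(1), of n \<kappa> X] by (simp add: theta_tilde_def)
    also have "\<dots> = (\<Sum>I\<in>Pow {1..n}. ?p I * (coord_part n X I i - \<theta> i))"
      unfolding sum_distrib_left sum_subtractf[symmetric]
      by (intro sum.cong) (auto simp: algebra_simps)
    finally show ?thesis
      using square_sum_weighted_le[of "Pow {1..n}" ?p "\<lambda>I. coord_part n X I i - \<theta> i"]
        post_nonneg[OF assms(1)] sum_post[OF assms(1)] by simp
  qed
  then have "(\<Sum>i\<in>{1..n}. (theta_tilde n \<sigma> \<kappa> X i - \<theta> i)\<^sup>2) \<le>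
      (\<Sum>i\<in>{1..n}. \<Sum>I\<in>Pow {1..n}. ?p I * (coord_part n X I i - \<theta> i)\<^sup>2)"
    by (rule sum_mono)
  also have "\<dots> = (\<Sum>I\<in>Pow {1..n}. ?p I * (\<Sum>i\<in>{1..n}. (coord_part n X I i - \<theta> i)\<^sup>2))"
    by (subst sum.swap) (simp add: sum_distrib_left)
  also have "\<dots> = (\<Sum>I\<in>Pow {1..n}. \<sigma>\<^sup>2 * (?p I * loss n (\<lambda>i. \<theta> i / \<sigma>) \<xi> I))"
  proof (intro sum.cong refl)
    fix I assume "I \<in> Pow {1..n}"
    then have "I \<subseteq> {1..n}" by simp
    then show "?p I * (\<Sum>i\<in>{1..n}. (coord_part n X I i - \<theta> i)\<^sup>2) =
        \<sigma>\<^sup>2 * (?p I * loss n (\<lambda>i. \<theta> i / \<sigma>) \<xi> I)"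
      by (subst sum_coord_part_error[OF assms(1) _ X]) auto
  qed
  finally show ?thesis by (simp add: sum_distrib_left)
qed

text \<open>The average bound serves the posterior mean and the minimizer bound serves the mode; in
  both cases minimality of \<open>Ihat X\<close> then expresses the bound through its
  complexity.\<close>

lemma estimator_error_le:
  assumes good: "good_event n \<kappa> u b \<tau>0 t M (\<lambda>i. X i / \<sigma>) (\<lambda>i. \<theta> i / \<sigma>) \<xi> J"
    and \<sigma>: "0 < \<sigma>" and X: "\<And>i. i \<in> {1..n} \<Longrightarrow> X i = \<theta> i + \<sigma> * \<xi> i" "X \<in> space (Rn n)"
    and sel: "eb_selector n \<sigma> \<kappa> Ihat"
    and \<theta>hat: "\<theta>hat \<in> {theta_tilde n \<sigma> \<kappa>, theta_check n Ihat}"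
  shows "(\<Sum>i\<in>{1..n}. (\<theta>hat X i - \<theta> i)\<^sup>2) \<le>
    \<sigma>\<^sup>2 * (risk_const \<kappa> u b \<tau>0 * (t + 1) * (1 + ell n (Ihat X) + M))"
proof -
  interpret good_event n \<kappa> u b \<tau>0 t M "\<lambda>i. X i / \<sigma>" "\<lambda>i. \<theta> i / \<sigma>" \<xi> J by (rule good)
  note I = eb_selector_subset[OF sel X(2)]
  note min = eb_selector_crit_le[OF sel X(2) \<sigma>]
  note bound = loss_bound_le[OF I min]
  consider "\<theta>hat = theta_tilde n \<sigma> \<kappa>" | "\<theta>hat = theta_check n Ihat" using \<theta>hat by blast
  then show ?thesis
  proof cases
    case 1
    have "(\<Sum>I\<in>Pow {1..n}. post n \<sigma> \<kappa> X I * loss n (\<lambda>i. \<theta> i / \<sigma>) \<xi> I) \<le>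
        risk_const \<kappa> u b \<tau>0 * (t + 1) * (1 + ell n (Ihat X) + M)"
      using post_nonneg[OF \<sigma>] sum_post[OF \<sigma>] post_le_exp_crit_diff[OF \<sigma>]
      by (intro order_trans[OF loss_weighted_le bound]) auto
    then show ?thesis
      unfolding 1 by (intro order_trans[OF theta_tilde_error_le[OF \<sigma> X(1)]] mult_left_mono) auto
  next
    case 2
    have "(\<Sum>i\<in>{1..n}. (\<theta>hat X i - \<theta> i)\<^sup>2) = \<sigma>\<^sup>2 * loss n (\<lambda>i. \<theta> i / \<sigma>) \<xi> (Ihat X)"
      unfolding 2 theta_check_def by (rule sum_coord_part_error[OF \<sigma> I X(1)])
    moreover have "loss n (\<lambda>i. \<theta> i / \<sigma>) \<xi> (Ihat X) \<le>
        risk_const \<kappa> u b \<tau>0 * (t + 1) * (1 + ell n (Ihat X) + M)"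
      by (rule order_trans[OF loss_minimizer_le[OF I min] bound])
    ultimately show ?thesis by (simp add: mult_left_mono)
  qed
qed

section \<open>Choice of constants and control of the exceptional events\<close>

theorem theorem3:
  fixes \<beta> B \<kappa> \<rho> \<tau>0 :: real
  assumes "0 < \<beta>" and "\<beta> \<le> 1" and "0 < B"
    and "1 < \<kappa>" and "\<kappa> > (12 - \<beta> + 4 * B) / (4 * \<beta>)"
    and "0 < \<rho>" and "\<rho> < 1" and "\<tau>0 > (1 + \<rho>) / (1 - \<rho>) * tau_bar \<beta> B \<kappa>"
  shows "\<exists>M2 H2 m2 M0' H0' :: real. M2 > 0 \<and> H2 > 0 \<and> m2 > 0 \<and> M0' > 0 \<and> H0' > 0 \<and>
    (\<forall>n \<sigma> (Q :: (nat \<Rightarrow> real) \<Rightarrow> (nat \<Rightarrow> real) measure) Ihat.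
      n \<ge> 1 \<longrightarrow> \<sigma> > 0 \<longrightarrow>
      (\<forall>\<theta>\<in>space (Rn n). noise_law n (Q \<theta>) \<and> exch_exp_moment n \<beta> B (Q \<theta>)) \<longrightarrow>
      eb_selector n \<sigma> \<kappa> Ihat \<longrightarrow>
      (\<forall>\<theta>hat \<in> {theta_tilde n \<sigma> \<kappa>, theta_check n Ihat}. \<forall>t\<ge>0. \<forall>M\<ge>0.
        (let Rhat = (\<lambda>X. sqrt ((t + 1) * M2 * rhat2 n \<sigma> Ihat X + (t + 2) * M * \<sigma>\<^sup>2)) in
          (SUP \<theta>\<in>eb_class n \<sigma> \<tau>0 t.
             measure (obs_law n \<sigma> (Q \<theta>) \<theta>) {X \<in> space (Rn n). \<theta> \<notin> Rball n (\<theta>hat X) (Rhat X)})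
           \<le> H2 * exp (- m2 * M)) \<and>
        (SUP \<theta>\<in>space (Rn n).
           measure (obs_law n \<sigma> (Q \<theta>) \<theta>)
             {X \<in> space (Rn n).
               rhat2 n \<sigma> Ihat X \<ge> M0' * \<sigma>\<^sup>2 * ell n (oracle_set n \<theta> (\<sigma>\<^sup>2)) + (M + 1) * \<sigma>\<^sup>2})
         \<le> H0' * exp (- M)))"
proof -
  define u b C K where "u = 1 / \<beta>" and "b = B / \<beta>" and "C = risk_const \<kappa> u b \<tau>0"
    and "K = 1 / (1 - exp (- (1 / 4) :: real))"
  have u: "1 \<le> u" and b: "0 \<le> b" using assms by (auto simp: u_def b_def)
  \<comment> \<open>Doubled, the lower bound on \<open>\<kappa>\<close> is the condition on the
    penalty factor under which both comparisons work.\<close>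
  have "6 * u + 2 * b - 1 / 2 = 2 * ((12 - \<beta> + 4 * B) / (4 * \<beta>))"
    using assms(1) by (simp add: u_def b_def field_simps)
  then have \<kappa>: "6 * u + 2 * b + 1 / 2 \<le> 2 * \<kappa> + 1" using assms(5) by linarith
  have tb: "tau_bar \<beta> B \<kappa> = 3 * \<kappa> + 3 / 2 + 3 * b"
    using assms(1) by (simp add: tau_bar_def b_def field_simps)
  then have "0 \<le> tau_bar \<beta> B \<kappa>" using assms(4) b by linarith
  moreover have "1 \<le> (1 + \<rho>) / (1 - \<rho>)" using assms(6,7) by simp
  \<comment> \<open>The factor in \<open>\<rho>\<close> is at least 1, so \<open>\<tau>0\<close>
    exceeds \<open>tau_bar\<close> itself.\<close>
  ultimately have "1 * tau_bar \<beta> B \<kappa> \<le> (1 + \<rho>) / (1 - \<rho>) * tau_bar \<beta> B \<kappa>"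
    by (intro mult_right_mono)
  then have \<tau>0: "3 * \<kappa> + 3 / 2 + 3 * b < \<tau>0" using assms(8) tb by linarith
  have C: "0 < C" using risk_const_pos[OF _ b _ \<tau>0] u assms(4) by (simp add: C_def)
  have K: "0 < K" by (simp add: K_def)
  \<comment> \<open>The inequality is strict because \<open>excess_noise\<close> contains its
    boundary; the size bound, whose event is stated with \<open>\<ge>\<close>, requires
    this.\<close>
  have noise_lt: "(\<Sum>i\<in>I. (\<xi> i)\<^sup>2) < (b + a * u) * ell n I + u * M"
    if "\<xi> \<in> space (Rn n)" "\<xi> \<notin> excess_noise n \<beta> B a M I" for n a M I \<xi>
    using that assms(1) by (simp add: excess_noise_def u_def b_def field_simps)
  have main: "measure (obs_law n \<sigma> Q \<theta>)
        {X \<in> space (Rn n). \<theta> \<notin> Rball n (\<theta>hat X) (sqrt ((t + 1) * C * rhat2 n \<sigma> Ihat X + (t + 2) * M * \<sigma>\<^sup>2))}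
      \<le> (K + 1) * exp (- (1 / C) * M)"
    if \<sigma>: "0 < \<sigma>" and Q: "noise_law n Q" "exch_exp_moment n \<beta> B Q" and sel: "eb_selector n \<sigma> \<kappa> Ihat"
      and \<theta>hat: "\<theta>hat \<in> {theta_tilde n \<sigma> \<kappa>, theta_check n Ihat}" and t: "0 \<le> t" and M: "0 \<le> M"
      and \<theta>: "\<theta> \<in> eb_class n \<sigma> \<tau>0 t" for n \<sigma> Q Ihat \<theta>hat t M \<theta>
  proof -
    interpret prob_space Q using Q(1) by (simp add: noise_law_def)
    have sets: "sets Q = sets (Rn n)" using Q(1) by (simp add: noise_law_def)
    define J where "J = oracle_set n \<theta> (\<tau>0 * \<sigma>\<^sup>2)"
    have J_oracle: "is_oracle n \<tau>0 (\<lambda>i. \<theta> i / \<sigma>) J"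
      unfolding J_def by (rule is_oracle_oracle_set[OF \<sigma>])
    then have J: "J \<subseteq> {1..n}" by (simp add: is_oracle_def)
    have bias: "(\<Sum>i\<in>{1..n} - J. (\<theta> i / \<sigma>)\<^sup>2) \<le> t * (1 + ell n J)"
      using \<theta> \<sigma> unfolding eb_class_def J_def[symmetric]
      by (simp add: Let_def power_divide divide_le_eq mult_ac flip: sum_divide_distrib J_def)
    \<comment> \<open>The noise level is \<open>M / C\<close>, so that multiplication by
      \<open>C\<close> returns \<open>M\<close>; the price is the rate \<open>1 / C\<close>. The
      union over all sets contributes \<open>K\<close> to the constant, the single set
      \<open>J\<close> contributes 1.\<close>
    define E where "E = (\<Union>I\<in>Pow {1..n}. excess_noise n \<beta> B (1 + 1 / 4) (M / C) I)"
    define F where "F = excess_noise n \<beta> B 0 (M / C) J"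
    have E: "E \<in> sets Q" and F: "F \<in> sets Q"
      unfolding E_def F_def sets using J by (auto intro!: sets.finite_UN excess_noise_sets simp del: One_nat_def)
    have "measure Q (E \<union> F) \<le> measure Q E + measure Q F"
      by (rule measure_Un_le[OF E F])
    also have "\<dots> \<le> K * exp (- (M / C)) + exp (- 0 * ell n J) * exp (- (M / C))"
      unfolding E_def F_def K_def using assms(3) J
      by (intro add_mono measure_Union_excess_noise_le[OF Q] measure_excess_noise_le[OF Q]) auto
    finally have EF: "measure Q (E \<union> F) \<le> (K + 1) * exp (- (1 / C) * M)"
      by (simp add: algebra_simps)
    show ?thesis
    proof (rule measure_obs_law_le[OF Q(1) sets.Un[OF E F] EF])
      fix \<xi> assume \<xi>: "\<xi> \<in> space (Rn n)" "\<xi> \<notin> E \<union> F"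
      define X where "X = (\<lambda>i\<in>{1..n}. \<theta> i + \<sigma> * \<xi> i)"
      have X: "X i = \<theta> i + \<sigma> * \<xi> i" if "i \<in> {1..n}" for i using that by (simp add: X_def)
      have Xs: "X \<in> space (Rn n)" by (auto simp: X_def space_PiM)
      have good: "good_event n \<kappa> u b \<tau>0 t (M / C) (\<lambda>i. X i / \<sigma>) (\<lambda>i. \<theta> i / \<sigma>) \<xi> J"
      proof
        fix I assume "I \<subseteq> {1..n}"
        then have "\<xi> \<notin> excess_noise n \<beta> B (1 + 1 / 4) (M / C) I" using \<xi>(2) by (auto simp: E_def)
        from noise_lt[OF \<xi>(1) this]
        show "(\<Sum>i\<in>I. (\<xi> i)\<^sup>2) \<le> (b + 5 / 4 * u) * ell n I + u * (M / C)" by simp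
      next
        have "\<xi> \<notin> excess_noise n \<beta> B 0 (M / C) J" using \<xi>(2) by (simp add: F_def)
        from noise_lt[OF \<xi>(1) this]
        show "(\<Sum>i\<in>J. (\<xi> i)\<^sup>2) \<le> b * ell n J + u * (M / C)" by simp
      next
        show "X i / \<sigma> = \<theta> i / \<sigma> + \<xi> i" if "i \<in> {1..n}" for i
          using X[OF that] \<sigma> by (simp add: field_simps)
      qed (use u b t M C \<kappa> \<tau>0 assms(4) J_oracle bias in auto)
      have "(\<Sum>i\<in>{1..n}. (\<theta>hat X i - \<theta> i)\<^sup>2) \<le> \<sigma>\<^sup>2 * (C * (t + 1) * (1 + ell n (Ihat X) + M / C))"
        unfolding C_def by (rule estimator_error_le[OF good[unfolded C_def] \<sigma> X Xs sel \<theta>hat])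
      also have "\<dots> = (t + 1) * C * rhat2 n \<sigma> Ihat X + (t + 1) * M * \<sigma>\<^sup>2"
        using C by (simp add: rhat2_def field_simps)
      also have "\<dots> \<le> (t + 1) * C * rhat2 n \<sigma> Ihat X + (t + 2) * M * \<sigma>\<^sup>2"
        using M by (intro add_left_mono mult_right_mono) auto
      finally have "\<theta> \<in> Rball n (\<theta>hat X) (sqrt ((t + 1) * C * rhat2 n \<sigma> Ihat X + (t + 2) * M * \<sigma>\<^sup>2))"
        using \<theta> by (simp add: Rball_def L2_set_def eb_class_def)
      then show "(\<lambda>i\<in>{1..n}. \<theta> i + \<sigma> * \<xi> i) \<notin> {X \<in> space (Rn n). \<theta> \<notin> Rball n (\<theta>hat X)
          (sqrt ((t + 1) * C * rhat2 n \<sigma> Ihat X + (t + 2) * M * \<sigma>\<^sup>2))}"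
        by (simp add: X_def)
    qed
  qed
  have size: "measure (obs_law n \<sigma> Q \<theta>)
        {X \<in> space (Rn n). rhat2 n \<sigma> Ihat X \<ge> (2 * \<kappa> + 1) * \<sigma>\<^sup>2 * ell n (oracle_set n \<theta> (\<sigma>\<^sup>2)) + (M + 1) * \<sigma>\<^sup>2}
      \<le> K * exp (- M)"
    if \<sigma>: "0 < \<sigma>" and Q: "noise_law n Q" "exch_exp_moment n \<beta> B Q" and sel: "eb_selector n \<sigma> \<kappa> Ihat"
    for n \<sigma> Q Ihat M \<theta>
  proof -
    have sets: "sets Q = sets (Rn n)" using Q(1) by (simp add: noise_law_def)
    \<comment> \<open>Here the noise level is \<open>M\<close> itself, as
      \<open>ell_less_of_crit_le\<close> leaves \<open>M\<close> with coefficient 1.\<close>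
    define E where "E = (\<Union>I\<in>Pow {1..n}. excess_noise n \<beta> B (1 + 1 / 4) M I)"
    have E: "E \<in> sets Q"
      unfolding E_def sets by (auto intro!: sets.finite_UN excess_noise_sets simp del: One_nat_def)
    have EK: "measure Q E \<le> K * exp (- M)"
      unfolding E_def K_def using assms(3) by (intro measure_Union_excess_noise_le[OF Q]) auto
    define J where "J = oracle_set n \<theta> (\<sigma>\<^sup>2)"
    have J_oracle: "is_oracle n 1 (\<lambda>i. \<theta> i / \<sigma>) J"
      using is_oracle_oracle_set[OF \<sigma>, of n 1 \<theta>] by (simp add: J_def)
    then have J: "J \<subseteq> {1..n}" by (simp add: is_oracle_def)
    show ?thesis
    proof (rule measure_obs_law_le[OF Q(1) E EK])
      fix \<xi> assume \<xi>: "\<xi> \<in> space (Rn n)" "\<xi> \<notin> E"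
      define X where "X = (\<lambda>i\<in>{1..n}. \<theta> i + \<sigma> * \<xi> i)"
      have Xs: "X \<in> space (Rn n)" by (auto simp: X_def space_PiM)
      note I = eb_selector_subset[OF sel Xs]
      have "\<xi> \<notin> excess_noise n \<beta> B (1 + 1 / 4) M (Ihat X)" using \<xi>(2) I by (auto simp: E_def)
      from noise_lt[OF \<xi>(1) this]
      have noise: "(\<Sum>i\<in>Ihat X. (\<xi> i)\<^sup>2) < (b + 5 / 4 * u) * ell n (Ihat X) + u * M" by simp
      have "ell n (Ihat X) < (2 * \<kappa> + 1) * ell n J + M"
      proof (rule ell_less_of_crit_le[OF I _ J_oracle eb_selector_crit_le[OF sel Xs \<sigma> J] noise u \<kappa>])
        show "X i / \<sigma> = \<theta> i / \<sigma> + \<xi> i" if "i \<in> {1..n}" for i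
          using that \<sigma> by (simp add: X_def field_simps)
      qed (use assms(4) in simp)
      then have "\<sigma>\<^sup>2 * ell n (Ihat X) < \<sigma>\<^sup>2 * ((2 * \<kappa> + 1) * ell n J + M)"
        using \<sigma> by simp
      then show "(\<lambda>i\<in>{1..n}. \<theta> i + \<sigma> * \<xi> i) \<notin> {X \<in> space (Rn n). rhat2 n \<sigma> Ihat X \<ge>
          (2 * \<kappa> + 1) * \<sigma>\<^sup>2 * ell n (oracle_set n \<theta> (\<sigma>\<^sup>2)) + (M + 1) * \<sigma>\<^sup>2}"
        unfolding X_def[symmetric] J_def[symmetric] by (simp add: rhat2_def algebra_simps)
    qed
  qed
  have space_ne: "space (Rn n) \<noteq> {}" for n by (simp add: space_PiM PiE_eq_empty_iff)
  \<comment> \<open>A supremum of reals is bounded by \<open>cSUP_least\<close> over a nonempty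
    index set; the zero vector has no bias and lies in every class.\<close>
  have class_ne: "eb_class n \<sigma> \<tau>0 t \<noteq> {}" if "0 \<le> t" for n \<sigma> t
  proof -
    define J where "J = oracle_set n (\<lambda>i\<in>{1..n}. 0) (\<tau>0 * \<sigma>\<^sup>2)"
    have "J \<subseteq> {1..n}"
      using oracle_set_in_minimizers by (auto simp: oracle_minimizers_def is_arg_min_def J_def)
    then have "0 \<le> t * \<sigma>\<^sup>2 * (1 + ell n J)" using ell_nonneg that by simp
    then have "(\<lambda>i\<in>{1..n}. 0) \<in> eb_class n \<sigma> \<tau>0 t"
      by (simp add: eb_class_def Let_def space_PiM J_def)
    then show ?thesis by blast
  qed
  show ?thesis
  proof (intro exI conjI allI impI ballI)
    \<comment> \<open>The witnesses are \<open>M2 = C\<close>, \<open>H2 = K + 1\<close>,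
      \<open>m2 = 1 / C\<close>, \<open>M0' = 2 * \<kappa> + 1\<close> and
      \<open>H0' = K\<close>.\<close>
    show "0 < C" "0 < K + 1" "0 < 1 / C" "0 < 2 * \<kappa> + 1" "0 < K" using C K assms(4) by auto
  next
    fix n \<sigma> and Q :: "(nat \<Rightarrow> real) \<Rightarrow> (nat \<Rightarrow> real) measure" and Ihat \<theta>hat and t M :: real
    assume \<sigma>: "0 < \<sigma>" and Q: "\<forall>\<theta>\<in>space (Rn n). noise_law n (Q \<theta>) \<and> exch_exp_moment n \<beta> B (Q \<theta>)"
      and sel: "eb_selector n \<sigma> \<kappa> Ihat" and \<theta>hat: "\<theta>hat \<in> {theta_tilde n \<sigma> \<kappa>, theta_check n Ihat}"
      and t: "0 \<le> t" and M: "0 \<le> M"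
    have sub: "eb_class n \<sigma> \<tau>0 t \<subseteq> space (Rn n)" by (auto simp: eb_class_def)
    show "let Rhat = \<lambda>X. sqrt ((t + 1) * C * rhat2 n \<sigma> Ihat X + (t + 2) * M * \<sigma>\<^sup>2)
      in (SUP \<theta>\<in>eb_class n \<sigma> \<tau>0 t. measure (obs_law n \<sigma> (Q \<theta>) \<theta>)
          {X \<in> space (Rn n). \<theta> \<notin> Rball n (\<theta>hat X) (Rhat X)}) \<le> (K + 1) * exp (- (1 / C) * M)"
      unfolding Let_def
    proof (rule cSUP_least[OF class_ne[OF t]])
      fix \<theta> assume \<theta>: "\<theta> \<in> eb_class n \<sigma> \<tau>0 t"
      then have "\<theta> \<in> space (Rn n)" using sub by blast
      with Q have "noise_law n (Q \<theta>)" "exch_exp_moment n \<beta> B (Q \<theta>)" by blast+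
      from main[OF \<sigma> this sel \<theta>hat t M \<theta>]
      show "measure (obs_law n \<sigma> (Q \<theta>) \<theta>) {X \<in> space (Rn n). \<theta> \<notin> Rball n (\<theta>hat X)
          (sqrt ((t + 1) * C * rhat2 n \<sigma> Ihat X + (t + 2) * M * \<sigma>\<^sup>2))} \<le> (K + 1) * exp (- (1 / C) * M)" .
    qed
    show "(SUP \<theta>\<in>space (Rn n). measure (obs_law n \<sigma> (Q \<theta>) \<theta>) {X \<in> space (Rn n). rhat2 n \<sigma> Ihat X \<ge>
        (2 * \<kappa> + 1) * \<sigma>\<^sup>2 * ell n (oracle_set n \<theta> (\<sigma>\<^sup>2)) + (M + 1) * \<sigma>\<^sup>2}) \<le> K * exp (- M)"
    proof (rule cSUP_least[OF space_ne])
      fix \<theta> assume "\<theta> \<in> space (Rn n)"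
      with Q have "noise_law n (Q \<theta>)" "exch_exp_moment n \<beta> B (Q \<theta>)" by blast+
      from size[OF \<sigma> this sel]
      show "measure (obs_law n \<sigma> (Q \<theta>) \<theta>) {X \<in> space (Rn n). rhat2 n \<sigma> Ihat X \<ge>
        (2 * \<kappa> + 1) * \<sigma>\<^sup>2 * ell n (oracle_set n \<theta> (\<sigma>\<^sup>2)) + (M + 1) * \<sigma>\<^sup>2} \<le> K * exp (- M)" .
    qed
  qed
qed

end
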